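(* The $*$-algebra $\Lambda(L(Z_2))$ is not closed in $L(H)$, where $\Lambda:L(Z_2)\to L(H)$ is the Kalton--Swanson representation.
   Context: The scalar field is either $\mathbb{R}$ or $\mathbb{C}$. The Kalton--Peck space $Z_2$ is the twisted sum $\ell_2\oplus_{\Omega}\ell_2$, where $\Omega=\Omega_2$ is the quasi-linear map given on finitely supported vectors by $\Omega(x)(n)=x(n)\log\frac{\|x\|_2}{|x(n)|}$ (with value $0$ where $x(n)=0$); i.e. $Z_2$ is the space of pairs $(x,y)$ of sequences with $y\in\ell_2$, $x-\Omega y\in\ell_2$, with quasi-norm $\|(x,y)\|=\|x-\Omega y\|_2+\|y\|_2$, which is equivalent to a Banach space norm. $L(Z_2)$ is the algebra of bounded linear operators on $Z_2$. The form $\omega((x,y),(x',y'))=\langle x,y'\rangle-\langle y,x'\rangle$ (with the $\ell_2$ inner product, on finitely supported vectors, extended by continuity) is a symplectic form on $Z_2$, and the involution $*$ on $L(Z_2)$ is defined by $\omega(Tu,v)=\omega(u,T^*v)$. Let $\mathcal U$ be a non-trivial ultrafilter on $\mathbb{N}$ and $(e_n)$ the canonical basis of $\ell_2$. There is a symmetric bilinear (Hermitian sesquilinear in the complex case) positive form $(\cdot,\cdot)$ on $L(Z_2)$ determined by $(T,T)=\lim_{\mathcal U}\|T(e_n,0)\|_{Z_2}^2$. The Hilbert space $H$ is the completion of the quotient of $L(Z_2)$ by the subspace $\{T:(T,T)=0\}$, and $\widetilde T\in H$ denotes the element corresponding to $T\in L(Z_2)$. For $A\in L(Z_2)$, $\Lambda(A)\in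 L(H)$ is the bounded operator determined by $\Lambda(A)\widetilde T=\widetilde{AT}$ for $T\in L(Z_2)$. It is known (Kalton--Swanson) that $\Lambda$ is a well-defined norm one $*$-algebra homomorphism, sending $\mathrm{Id}$ to $\mathrm{Id}$, with kernel the ideal $S(Z_2)$ of strictly singular operators. Closedness is with respect to the operator norm of $L(H)$. *)

theory Defs
  imports "HOL-Analysis.Analysis" "Jordan_Normal_Form.Conjugate"
begin

section \<open>The scalar field\<close>

text \<open>
  The class of the two scalar fields. The second axiom says that the field is the image of the
  reals or is obtained from it by adjoining a square root of $-1$; the first one then forces
  \<open>conjugate\<close> to be the usual conjugation and the norm to be the usual modulus.
\<close>

class real_or_complex = real_normed_field + conjugatable_field +
  assumes mult_conjugate_self: "x * conjugate x = (norm x)\<^sup>2 *\<^sub>R 1"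
    and real_or_adjoin_i:
      "(\<forall>x. \<exists>a. x = a *\<^sub>R 1) \<or> (\<exists>i. i * i = -1 \<and> (\<forall>x. \<exists>a b. x = a *\<^sub>R 1 + b *\<^sub>R i))"

instance real :: real_or_complex
  by intro_classes (auto simp: power2_eq_square)

instance complex :: real_or_complex
proof
  fix x :: complex
  show "x * conjugate x = (norm x)\<^sup>2 *\<^sub>R 1"
    by (metis complex_norm_square conjugate_complex_def of_real_def)
  have "\<forall>x. \<exists>a b. x = a *\<^sub>R 1 + b *\<^sub>R \<i>"
    by (metis complex_eq mult.commute of_real_def scaleR_conv_of_real)
  then show "(\<forall>x::complex. \<exists>a. x = a *\<^sub>R 1) \<or>
      (\<exists>i::complex. i * i = - 1 \<and> (\<forall>x. \<exists>a b. x = a *\<^sub>R 1 + b *\<^sub>R i))"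
    using i_squared by blast
qed


section \<open>The Kalton--Peck space\<close>

definition ell2 :: "(nat \<Rightarrow> 'k::real_or_complex) set" where
  "ell2 = {x. summable (\<lambda>n. (norm (x n))\<^sup>2)}"

definition norm2 :: "(nat \<Rightarrow> 'k::real_or_complex) \<Rightarrow> real" where
  "norm2 x = sqrt (\<Sum>n. (norm (x n))\<^sup>2)"

definition Omega :: "(nat \<Rightarrow> 'k::real_or_complex) \<Rightarrow> (nat \<Rightarrow> 'k)" where
  "Omega x = (\<lambda>n. if x n = 0 then 0 else x n * of_real (ln (norm2 x / norm (x n))))"

type_synonym 'k seq_pair = "(nat \<Rightarrow> 'k) \<times> (nat \<Rightarrow> 'k)"

definition Z2 :: "'k::real_or_complex seq_pair set" where
  "Z2 = {(x, y). y \<in> ell2 \<and> (\<lambda>n. x n - Omega y n) \<in> ell2}"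

definition qnorm :: "'k::real_or_complex seq_pair \<Rightarrow> real" where
  "qnorm = (\<lambda>(x, y). norm2 (\<lambda>n. x n - Omega y n) + norm2 y)"

definition zero_pair :: "'k::real_or_complex seq_pair" where
  "zero_pair = (\<lambda>n. 0, \<lambda>n. 0)"

definition add_pair :: "'k::real_or_complex seq_pair \<Rightarrow> 'k seq_pair \<Rightarrow> 'k seq_pair" where
  "add_pair u v = (\<lambda>n. fst u n + fst v n, \<lambda>n. snd u n + snd v n)"

definition scale_pair :: "'k::real_or_complex \<Rightarrow> 'k seq_pair \<Rightarrow> 'k seq_pair" where
  "scale_pair a u = (\<lambda>n. a * fst u n, \<lambda>n. a * snd u n)"

definition unit_seq :: "nat \<Rightarrow> nat \<Rightarrow> 'k::real_or_complex" where
  "unit_seq n = (\<lambda>m. if m = n then 1 else 0)"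


section \<open>The algebra of bounded operators\<close>

type_synonym 'k pair_op = "'k seq_pair \<Rightarrow> 'k seq_pair"

text \<open>
  Operators are total functions on pairs of sequences; they are required to vanish off \<open>Z2\<close>, so
  that each bounded operator on \<open>Z2\<close> is represented exactly once. This convention is preserved by
  composition. Boundedness for the quasi-norm is the same as boundedness for an equivalent norm.
\<close>

definition LZ2 :: "'k::real_or_complex pair_op set" where
  "LZ2 = {T.
     (\<forall>u\<in>Z2. T u \<in> Z2) \<and> (\<forall>u. u \<notin> Z2 \<longrightarrow> T u = zero_pair) \<and>
     (\<forall>u\<in>Z2. \<forall>v\<in>Z2. T (add_pair u v) = add_pair (T u) (T v)) \<and>
     (\<forall>a. \<forall>u\<in>Z2. T (scale_pair a u) = scale_pair a (T u)) \<and>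
     (\<exists>C. \<forall>u\<in>Z2. qnorm (T u) \<le> C * qnorm u)}"

definition add_op :: "'k::real_or_complex pair_op \<Rightarrow> 'k pair_op \<Rightarrow> 'k pair_op" where
  "add_op S T = (\<lambda>u. add_pair (S u) (T u))"

definition scale_op :: "'k::real_or_complex \<Rightarrow> 'k pair_op \<Rightarrow> 'k pair_op" where
  "scale_op a T = (\<lambda>u. scale_pair a (T u))"


section \<open>The form associated with an ultrafilter\<close>

definition nontrivial_ultrafilter :: "nat filter \<Rightarrow> bool" where
  "nontrivial_ultrafilter U \<longleftrightarrow>
     U \<noteq> bot \<and> (\<forall>P. eventually P U \<or> eventually (\<lambda>n. \<not> P n) U) \<and>
     (\<forall>m. eventually (\<lambda>n. n \<noteq> m) U)"

text \<open>
  The positive Hermitian form on \<open>LZ2\<close> (symmetric bilinear over the reals) whose quadratic form is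
  the limit below. By polarization it is unique on \<open>LZ2\<close>.
\<close>

definition kalton_swanson_form ::
    "nat filter \<Rightarrow> ('k::real_or_complex pair_op \<Rightarrow> 'k pair_op \<Rightarrow> 'k) \<Rightarrow> bool" where
  "kalton_swanson_form U form \<longleftrightarrow>
     (\<forall>R\<in>LZ2. \<forall>S\<in>LZ2. \<forall>T\<in>LZ2. form (add_op R S) T = form R T + form S T) \<and>
     (\<forall>a. \<forall>S\<in>LZ2. \<forall>T\<in>LZ2. form (scale_op a S) T = a * form S T) \<and>
     (\<forall>S\<in>LZ2. \<forall>T\<in>LZ2. form T S = conjugate (form S T)) \<and>
     (\<forall>T\<in>LZ2. \<exists>r\<ge>0. form T T = of_real r \<and>
        ((\<lambda>n. (qnorm (T (unit_seq n, \<lambda>_. 0)))\<^sup>2) \<longlongrightarrow> r) U)"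


section \<open>The Hilbert space and the representation\<close>

text \<open>
  Hilbert spaces over the scalar field: completeness is the class \<open>banach\<close>, and the norm of
  the class is the one induced by the inner product. In the complex case the class only provides
  the underlying real scalar multiplication, hence the separate operation \<open>sc\<close>.
\<close>

locale hilbert_space_over = vector_space sc
  for sc :: "'k::real_or_complex \<Rightarrow> 'h::banach \<Rightarrow> 'h" +
  fixes ip :: "'h \<Rightarrow> 'h \<Rightarrow> 'k"
  assumes sc_of_real: "sc (of_real r) x = r *\<^sub>R x"
    and ip_add_left: "ip (x + y) z = ip x z + ip y z"
    and ip_scale_left: "ip (sc a x) y = a * ip x y"
    and ip_conjugate: "ip y x = conjugate (ip x y)"
    and ip_norm: "ip x x = of_real ((norm x)\<^sup>2)"

text \<open>
  \<open>H\<close> with \<open>tilde\<close> is a completion of the quotient of \<open>LZ2\<close> by the null space of the form, a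
  property that determines the pair up to unique isometric isomorphism. That \<open>tilde\<close> identifies
  exactly the operators differing by an element of the null space follows from the clause on inner
  products.
\<close>

definition completion_of_form ::
    "('k::real_or_complex pair_op \<Rightarrow> 'k pair_op \<Rightarrow> 'k) \<Rightarrow> ('k \<Rightarrow> 'h \<Rightarrow> 'h) \<Rightarrow> ('h \<Rightarrow> 'h \<Rightarrow> 'k) \<Rightarrow>
     ('k pair_op \<Rightarrow> 'h::banach) \<Rightarrow> bool" where
  "completion_of_form form sc ip tilde \<longleftrightarrow>
     hilbert_space_over sc ip \<and>
     (\<forall>S\<in>LZ2. \<forall>T\<in>LZ2. tilde (add_op S T) = tilde S + tilde T) \<and>
     (\<forall>a. \<forall>T\<in>LZ2. tilde (scale_op a T) = sc a (tilde T)) \<and>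
     (\<forall>S\<in>LZ2. \<forall>T\<in>LZ2. ip (tilde S) (tilde T) = form S T) \<and>
     closure (tilde ` LZ2) = UNIV"

definition bounded_ops ::
    "('k::real_or_complex \<Rightarrow> 'h::banach \<Rightarrow> 'h) \<Rightarrow> ('h \<Rightarrow>\<^sub>L 'h) set" where
  "bounded_ops sc = {\<Phi>. \<forall>a x. blinfun_apply \<Phi> (sc a x) = sc a (blinfun_apply \<Phi> x)}"

definition kalton_swanson_rep ::
    "('k::real_or_complex \<Rightarrow> 'h::banach \<Rightarrow> 'h) \<Rightarrow> ('k pair_op \<Rightarrow> 'h) \<Rightarrow> 'k pair_op \<Rightarrow> ('h \<Rightarrow>\<^sub>L 'h)" where
  "kalton_swanson_rep sc tilde A =
     (THE \<Phi>. \<Phi> \<in> bounded_ops sc \<and> (\<forall>T\<in>LZ2. blinfun_apply \<Phi> (tilde T) = tilde (A \<circ> T)))"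

end

theory Submission
  imports Defs
begin

text \<open>
  If \<open>T\<close> is bounded, the second components of \<open>T (e\<^sub>n, 0)\<close> tend to zero. Hence for a matrix \<open>\<alpha>\<close>
  commuting with \<open>\<Omega>\<close> up to a bounded error, the norm of \<open>\<Lambda> (diag (\<alpha>, \<alpha>))\<close> is at most the norm of
  \<open>\<alpha>\<close> on \<open>\<ell>\<^sub>2\<close>, however large that error is. Split the index set into infinitely many blocks of
  each size \<open>N\<^sub>k = 2 ^ (k + 1)\<^sup>2\<close> and let \<open>\<alpha>\<close> act on the blocks of size \<open>N\<^sub>k\<close> as \<open>1 / (k + 1)\<close> times
  the normalised Hadamard matrix. The truncations of \<open>\<alpha>\<close> to finitely many \<open>k\<close> give bounded operators
  whose images under \<open>\<Lambda>\<close> converge. If the limit were \<open>\<Lambda> B\<close>, then \<open>B\<close> would agree up to small errors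
  with \<open>(\<alpha>, 0)\<close> on vectors \<open>(e\<^sub>p, 0)\<close> from \<open>N\<^sub>k\<close> blocks of size \<open>N\<^sub>k\<close>. Write \<open>B\<close> as a matrix with entries
  \<open>a, b, c, d\<close> and pair \<open>B (\<Omega> y, y)\<close> with \<open>(\<Omega> z, z)\<close> in the symplectic form, where \<open>\<Omega> y = \<lambda> y\<close> and
  \<open>\<Omega> z = \<mu> z\<close>. Summing over orthonormal bases of such \<open>y\<close>, with \<open>z\<close> the Hadamard image of \<open>y\<close>, bounds
  \<open>\<lambda> tr a + tr b - \<lambda> \<mu> tr c - \<mu> tr d\<close>, where the twisted traces do not depend on the bases. The choices
  \<open>(L, 0)\<close>, \<open>(0, L)\<close>, \<open>(L, 2 L)\<close> of \<open>(\<lambda>, \<mu>)\<close>, with \<open>2 L = ln N\<^sub>k\<close>, bound \<open>L / (k + 1)\<close>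
  independently of \<open>k\<close>, which is absurd.
\<close>

section \<open>Square-summable sequences\<close>

text \<open>Norm estimates are made on initial segments and transferred by this lemma, so that only
  finite sums have to be manipulated.\<close>

lemma ell2_bounded:
  fixes x :: "nat \<Rightarrow> 'k::real_or_complex"
  assumes "\<And>n. L2_set (\<lambda>p. norm (x p)) {..<n} \<le> c"
  shows "x \<in> ell2" and "norm2 x \<le> c"
proof -
  have c: "c \<ge> 0" using assms[of 0] by simp
  have b: "(\<Sum>p<n. (norm (x p))\<^sup>2) \<le> c\<^sup>2" for n
    using assms[of n] c unfolding L2_set_def by (simp add: real_sqrt_le_iff real_le_rsqrt sqrt_le_D)
  have s: "summable (\<lambda>p. (norm (x p))\<^sup>2)"
    by (rule summableI_nonneg_bounded[where x="c\<^sup>2"]) (use b in auto)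
  show "x \<in> ell2" using s by (simp add: ell2_def)
  have "(\<Sum>p. (norm (x p))\<^sup>2) \<le> c\<^sup>2" by (rule suminf_le_const[OF s]) (use b in auto)
  then show "norm2 x \<le> c" unfolding norm2_def using c by (simp add: real_le_lsqrt)
qed

lemma L2_set_le_norm2:
  assumes "x \<in> ell2" "finite F"
  shows "L2_set (\<lambda>p. norm (x p)) F \<le> norm2 x"
  unfolding L2_set_def norm2_def
  by (rule real_sqrt_le_mono, rule sum_le_suminf) (use assms in \<open>auto simp: ell2_def\<close>)

lemma norm2_nonneg: "x \<in> ell2 \<Longrightarrow> 0 \<le> norm2 x"
  using L2_set_le_norm2[of x "{}"] by simp

lemma norm_le_norm2: "x \<in> ell2 \<Longrightarrow> norm (x p) \<le> norm2 x"
  using L2_set_le_norm2[of x "{p}"] by simp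

lemma ell2_dominated:
  fixes x y z :: "nat \<Rightarrow> 'k::real_or_complex"
  assumes x: "x \<in> ell2" and z: "z \<in> ell2" and ab: "a \<ge> 0" "b \<ge> 0"
    and le: "\<And>p. norm (y p) \<le> a * norm (x p) + b * norm (z p)"
  shows "y \<in> ell2" and "norm2 y \<le> a * norm2 x + b * norm2 z"
proof -
  have "L2_set (\<lambda>p. norm (y p)) {..<n} \<le> a * norm2 x + b * norm2 z" for n
  proof -
    have "L2_set (\<lambda>p. norm (y p)) {..<n} \<le> L2_set (\<lambda>p. a * norm (x p) + b * norm (z p)) {..<n}"
      by (rule L2_set_mono) (use le in auto)
    also have "\<dots> \<le> L2_set (\<lambda>p. a * norm (x p)) {..<n} + L2_set (\<lambda>p. b * norm (z p)) {..<n}"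
      by (rule L2_set_triangle_ineq)
    also have "\<dots> = a * L2_set (\<lambda>p. norm (x p)) {..<n} + b * L2_set (\<lambda>p. norm (z p)) {..<n}"
      using ab by (simp add: L2_set_right_distrib)
    also have "\<dots> \<le> a * norm2 x + b * norm2 z"
      using ab x z by (intro add_mono mult_left_mono L2_set_le_norm2) auto
    finally show ?thesis .
  qed
  from ell2_bounded[of y, OF this] show "y \<in> ell2" "norm2 y \<le> a * norm2 x + b * norm2 z" by auto
qed

lemma ell2_add:
  assumes "x \<in> ell2" "y \<in> ell2"
  shows "(\<lambda>p. x p + y p) \<in> ell2" and "norm2 (\<lambda>p. x p + y p) \<le> norm2 x + norm2 y"
  using ell2_dominated[OF assms, of 1 1 "\<lambda>p. x p + y p"] by (auto intro: norm_triangle_ineq)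

lemma ell2_diff:
  assumes "x \<in> ell2" "y \<in> ell2"
  shows "(\<lambda>p. x p - y p) \<in> ell2" and "norm2 (\<lambda>p. x p - y p) \<le> norm2 x + norm2 y"
  using ell2_dominated[OF assms, of 1 1 "\<lambda>p. x p - y p"] by (auto intro: norm_triangle_ineq4)

lemma ell2_scale:
  assumes "x \<in> ell2"
  shows "(\<lambda>p. a * x p) \<in> ell2" and "norm2 (\<lambda>p. a * x p) = norm a * norm2 x"
proof -
  have s: "summable (\<lambda>n. (norm (x n))\<^sup>2)" using assms by (simp add: ell2_def)
  show "(\<lambda>p. a * x p) \<in> ell2"
    using summable_mult[OF s, of "(norm a)\<^sup>2"] by (simp add: ell2_def norm_mult power_mult_distrib)
  show "norm2 (\<lambda>p. a * x p) = norm a * norm2 x"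
    unfolding norm2_def using suminf_mult[OF s, of "(norm a)\<^sup>2"]
    by (simp add: norm_mult power_mult_distrib real_sqrt_mult)
qed

lemma ell2_finite:
  assumes "finite F" "\<And>p. p \<notin> F \<Longrightarrow> x p = 0"
  shows "x \<in> ell2" and "norm2 x = L2_set (\<lambda>p. norm (x p)) F"
proof -
  show "x \<in> ell2" unfolding ell2_def using assms
    by (auto intro!: summable_finite[of F])
  have "(\<Sum>n. (norm (x n))\<^sup>2) = (\<Sum>n\<in>F. (norm (x n))\<^sup>2)"
    by (rule suminf_finite) (use assms in auto)
  then show "norm2 x = L2_set (\<lambda>p. norm (x p)) F" by (simp add: norm2_def L2_set_def)
qed

lemma ell2_zero: "(\<lambda>n. 0) \<in> ell2" and norm2_zero: "norm2 (\<lambda>n. 0) = 0"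
  using ell2_finite[of "{}" "\<lambda>n. 0"] by auto

lemma norm2_eq_0: "x \<in> ell2 \<Longrightarrow> norm2 x = 0 \<Longrightarrow> x = (\<lambda>n. 0)"
  using norm_le_norm2 by fastforce

section \<open>The Kalton--Peck map\<close>

lemma Omega_apply: "Omega x n = x n * of_real (ln (norm2 x / norm (x n)))"
  by (simp add: Omega_def)

text \<open>For \<open>t > 0\<close> this is \<open>ln s \<le> s - 1\<close> at
  \<open>s = R / t\<close>, where \<open>0 \<le> ln s\<close> removes the absolute value.\<close>

lemma mult_abs_ln_le:
  fixes t R :: real
  assumes "0 \<le> t" "t \<le> R"
  shows "t * \<bar>ln (R / t)\<bar> \<le> R"
proof (cases "t = 0")
  case False
  then have "ln (R / t) \<le> R / t - 1" "0 \<le> ln (R / t)" using assms by (auto intro!: ln_le_minus_one)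
  then have "t * ln (R / t) \<le> t * (R / t - 1)" using assms by (intro mult_left_mono) auto
  also have "\<dots> \<le> R" using False assms by (simp add: field_simps)
  finally show ?thesis using \<open>0 \<le> ln (R / t)\<close> by simp
qed (use assms in auto)

lemma mult_of_real_ln_rescale:
  fixes a :: "'k::real_or_complex"
  assumes "R > 0" "S > 0"
  shows "a * of_real (ln (R / norm a)) = a * of_real (ln (S / norm a)) + a * of_real (ln (R / S))"
proof (cases "a = 0")
  case False
  then have "ln (R / norm a) = ln (S / norm a) + ln (R / S)" using assms by (simp add: ln_div)
  then show ?thesis by (simp add: distrib_left)
qed simp

text \<open>The expression does not depend on the scale \<open>R\<close>, because
  \<open>(a + b) - a - b = 0\<close> cancels a change of scale. At the scale
  \<open>m = norm a + norm b\<close> each of the three terms is at most \<open>m\<close>.\<close>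

lemma norm_entropy_defect:
  fixes a b :: "'k::real_or_complex"
  assumes "R > 0"
  shows "norm ((a + b) * of_real (ln (R / norm (a + b))) - a * of_real (ln (R / norm a))
           - b * of_real (ln (R / norm b))) \<le> 3 * norm a + 3 * norm b"
proof (cases "norm a + norm b = 0")
  case False
  define m where "m = norm a + norm b"
  have m: "m > 0" using False m_def by (simp add: add_nonneg_pos order_less_le)
  have e: "norm (c * of_real (ln (m / norm c))) \<le> m" if "norm c \<le> m" for c :: 'k
    using mult_abs_ln_le[of "norm c" m] that by (simp add: norm_mult)
  have "(a + b) * of_real (ln (R / norm (a + b))) - a * of_real (ln (R / norm a))
           - b * of_real (ln (R / norm b)) =
        (a + b) * of_real (ln (m / norm (a + b))) - a * of_real (ln (m / norm a))
           - b * of_real (ln (m / norm b))"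
    by (simp only: mult_of_real_ln_rescale[OF assms m, of "a+b"] mult_of_real_ln_rescale[OF assms m, of a]
        mult_of_real_ln_rescale[OF assms m, of b]) (simp add: algebra_simps)
  also have "norm \<dots> \<le> m + m + m"
    by (intro order_trans[OF norm_triangle_ineq4] add_mono e) (auto simp: m_def norm_triangle_ineq)
  finally show ?thesis by (simp add: m_def)
next
  case True
  then have "a = 0" "b = 0" by (auto simp: add_nonneg_eq_0_iff)
  then show ?thesis by simp
qed

lemma ell2_scale_ln:
  assumes "x \<in> ell2" "norm2 x \<le> R"
  shows "(\<lambda>p. x p * of_real (ln (R / norm2 x))) \<in> ell2"
    and "norm2 (\<lambda>p. x p * of_real (ln (R / norm2 x))) \<le> R"
  using ell2_scale[OF assms(1), of "of_real (ln (R / norm2 x))"]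
    mult_abs_ln_le[OF norm2_nonneg[OF assms(1)] assms(2)] by (auto simp: mult.commute)

text \<open>Allows vectors of different norms to be compared at one scale \<open>R\<close>. The
  correction is a scalar multiple of \<open>x\<close>, controlled by \<open>ell2_scale_ln\<close>
  when \<open>norm2 x \<le> R\<close>.\<close>

lemma Omega_rescale:
  assumes "x \<in> ell2" "R > 0"
  shows "Omega x p = x p * of_real (ln (R / norm (x p))) - x p * of_real (ln (R / norm2 x))"
proof (cases "norm2 x = 0")
  case False
  then have "norm2 x > 0" using norm2_nonneg[OF assms(1)] by simp
  from mult_of_real_ln_rescale[OF assms(2) this, of "x p"] show ?thesis by (simp add: Omega_apply)
next
  case True
  with norm2_eq_0[OF assms(1)] show ?thesis by (simp add: Omega_apply)
qed

text \<open>Quasi-linearity of the Kalton-Peck map. At the common scale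
  \<open>R = norm2 x + norm2 y\<close> the pointwise defect contributes \<open>3 * R\<close> and the
  three scale corrections contribute \<open>R\<close> each.\<close>

lemma Omega_add:
  assumes x: "x \<in> ell2" and y: "y \<in> ell2"
  shows "(\<lambda>p. Omega (\<lambda>n. x n + y n) p - Omega x p - Omega y p) \<in> ell2"
    and "norm2 (\<lambda>p. Omega (\<lambda>n. x n + y n) p - Omega x p - Omega y p) \<le> 6 * (norm2 x + norm2 y)"
proof -
  define R where "R = norm2 x + norm2 y"
  let ?D = "\<lambda>p. Omega (\<lambda>n. x n + y n) p - Omega x p - Omega y p"
  have nn: "norm2 x \<ge> 0" "norm2 y \<ge> 0" using x y norm2_nonneg by auto
  have "?D \<in> ell2 \<and> norm2 ?D \<le> 6 * R"
  proof (cases "R = 0")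
    case True
    then have "norm2 x = 0" "norm2 y = 0" using nn unfolding R_def by auto
    then have "x = (\<lambda>n. 0)" "y = (\<lambda>n. 0)" using x y norm2_eq_0 by auto
    then show ?thesis by (simp add: Omega_apply ell2_zero norm2_zero True)
  next
    case False
    then have R: "R > 0" using nn R_def by simp
    let ?w = "\<lambda>n. x n + y n"
    let ?E = "\<lambda>u p. u p * of_real (ln (R / norm2 u))"
    let ?f = "\<lambda>p. ?w p * of_real (ln (R / norm (?w p))) - x p * of_real (ln (R / norm (x p)))
              - y p * of_real (ln (R / norm (y p)))"
    note w = ell2_add[OF x y]
    have f0: "norm (?f p) \<le> 3 * norm (x p) + 3 * norm (y p)" for p by (rule norm_entropy_defect[OF R])
    have f: "?f \<in> ell2" "norm2 ?f \<le> 3 * norm2 x + 3 * norm2 y"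
      using ell2_dominated[OF x y _ _ f0] by simp_all
    have ew: "?E ?w \<in> ell2" "norm2 (?E ?w) \<le> R" using ell2_scale_ln[OF w(1), of R] w(2) R_def by auto
    have ex: "?E x \<in> ell2" "norm2 (?E x) \<le> R" using ell2_scale_ln[OF x, of R] nn R_def by auto
    have ey: "?E y \<in> ell2" "norm2 (?E y) \<le> R" using ell2_scale_ln[OF y, of R] nn R_def by auto
    have eq: "?D = (\<lambda>p. (?f p - ?E ?w p) + (?E x p + ?E y p))"
      by (simp add: Omega_rescale[OF x R] Omega_rescale[OF y R] Omega_rescale[OF w(1) R] algebra_simps)
    note d = ell2_diff[OF f(1) ew(1)] and s = ell2_add[OF ex(1) ey(1)]
    show ?thesis unfolding eq using ell2_add[OF d(1) s(1)] d(2) s(2) f(2) ew(2) ex(2) ey(2)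
      by (auto simp: R_def)
  qed
  then show "?D \<in> ell2" "norm2 ?D \<le> 6 * (norm2 x + norm2 y)" by (auto simp: R_def)
qed

lemma Omega_scale:
  assumes "y \<in> ell2"
  shows "Omega (\<lambda>n. a * y n) p = a * Omega y p"
  using ell2_scale(2)[OF assms, of a] by (cases "a = 0") (auto simp: Omega_apply norm_mult)

section \<open>The space and its operators\<close>

lemma Z2_iff: "(x, y) \<in> Z2 \<longleftrightarrow> y \<in> ell2 \<and> (\<lambda>n. x n - Omega y n) \<in> ell2"
  by (simp add: Z2_def)

lemma qnorm_Pair: "qnorm (x, y) = norm2 (\<lambda>n. x n - Omega y n) + norm2 y"
  by (simp add: qnorm_def)

lemma qnorm_nonneg: "u \<in> Z2 \<Longrightarrow> 0 \<le> qnorm u"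
  by (cases u) (auto simp: Z2_iff qnorm_Pair intro!: add_nonneg_nonneg norm2_nonneg)

lemma Omega_zero: "Omega (\<lambda>n. 0) = (\<lambda>n. 0)"
  by (simp add: Omega_def)

lemma Z2_fst: "(x, \<lambda>n. 0) \<in> Z2 \<longleftrightarrow> x \<in> ell2"
  by (simp add: Z2_iff Omega_zero ell2_zero)

lemma qnorm_fst: "qnorm (x, \<lambda>n. 0) = norm2 x"
  by (simp add: qnorm_Pair Omega_zero norm2_zero)

lemma Z2_Omega: "y \<in> ell2 \<Longrightarrow> (Omega y, y) \<in> Z2"
  by (simp add: Z2_iff ell2_zero)

lemma qnorm_Omega: "qnorm (Omega y, y) = norm2 y"
  by (simp add: qnorm_Pair norm2_zero)

lemma zero_pair_Z2: "zero_pair \<in> Z2"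
  by (simp add: zero_pair_def Z2_fst ell2_zero)

text \<open>The factor 7 is the quasi-linearity constant 6 plus 1 for the second component.\<close>

lemma Z2_add:
  assumes "u \<in> Z2" "v \<in> Z2"
  shows "add_pair u v \<in> Z2" and "qnorm (add_pair u v) \<le> 7 * (qnorm u + qnorm v)"
proof -
  obtain x y where u: "u = (x, y)" by (cases u)
  obtain x' y' where v: "v = (x', y')" by (cases v)
  have y: "y \<in> ell2" "y' \<in> ell2" and x: "(\<lambda>n. x n - Omega y n) \<in> ell2" "(\<lambda>n. x' n - Omega y' n) \<in> ell2"
    using assms by (auto simp: u v Z2_iff)
  note O = Omega_add[OF y] and s = ell2_add[OF x] and ys = ell2_add[OF y]
  have eq: "(\<lambda>n. x n + x' n - Omega (\<lambda>n. y n + y' n) n) =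
      (\<lambda>p. (x p - Omega y p + (x' p - Omega y' p)) - (Omega (\<lambda>n. y n + y' n) p - Omega y p - Omega y' p))"
    by (simp add: algebra_simps)
  note d = ell2_diff[OF s(1) O(1)]
  show "add_pair u v \<in> Z2" using d(1) ys(1) by (simp add: add_pair_def u v Z2_iff eq)
  have nn: "0 \<le> norm2 y" "0 \<le> norm2 y'" "0 \<le> norm2 (\<lambda>n. x n - Omega y n)" "0 \<le> norm2 (\<lambda>n. x' n - Omega y' n)"
    using x y norm2_nonneg by auto
  show "qnorm (add_pair u v) \<le> 7 * (qnorm u + qnorm v)"
    using d(2) ys(2) O(2) s(2) nn by (simp add: add_pair_def u v qnorm_Pair eq)
qed

lemma Z2_scale:
  assumes "u \<in> Z2"
  shows "scale_pair a u \<in> Z2" and "qnorm (scale_pair a u) = norm a * qnorm u"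
proof -
  obtain x y where u: "u = (x, y)" by (cases u)
  have y: "y \<in> ell2" and x: "(\<lambda>n. x n - Omega y n) \<in> ell2" using assms by (auto simp: u Z2_iff)
  have eq: "(\<lambda>n. a * x n - Omega (\<lambda>n. a * y n) n) = (\<lambda>n. a * (x n - Omega y n))"
    by (simp add: Omega_scale[OF y] algebra_simps)
  show "scale_pair a u \<in> Z2" using ell2_scale(1)[OF x] ell2_scale(1)[OF y]
    by (simp add: scale_pair_def u Z2_iff eq)
  show "qnorm (scale_pair a u) = norm a * qnorm u" using ell2_scale(2)[OF x] ell2_scale(2)[OF y]
    by (simp add: scale_pair_def u qnorm_Pair eq distrib_left)
qed

lemma LZ2I:
  assumes "\<And>u. u \<in> Z2 \<Longrightarrow> T u \<in> Z2" "\<And>u. u \<notin> Z2 \<Longrightarrow> T u = zero_pair"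
    "\<And>u v. u \<in> Z2 \<Longrightarrow> v \<in> Z2 \<Longrightarrow> T (add_pair u v) = add_pair (T u) (T v)"
    "\<And>a u. u \<in> Z2 \<Longrightarrow> T (scale_pair a u) = scale_pair a (T u)"
    "\<And>u. u \<in> Z2 \<Longrightarrow> qnorm (T u) \<le> C * qnorm u"
  shows "T \<in> LZ2"
  using assms unfolding LZ2_def by blast

lemma LZ2D:
  assumes "T \<in> LZ2"
  shows "u \<in> Z2 \<Longrightarrow> T u \<in> Z2" "u \<notin> Z2 \<Longrightarrow> T u = zero_pair"
    "u \<in> Z2 \<Longrightarrow> v \<in> Z2 \<Longrightarrow> T (add_pair u v) = add_pair (T u) (T v)"
    "u \<in> Z2 \<Longrightarrow> T (scale_pair a u) = scale_pair a (T u)"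
  using assms unfolding LZ2_def by blast+

lemma LZ2_bound:
  assumes "T \<in> LZ2"
  obtains C where "C > 0" "\<And>u. u \<in> Z2 \<Longrightarrow> qnorm (T u) \<le> C * qnorm u"
proof -
  obtain C where C: "\<And>u. u \<in> Z2 \<Longrightarrow> qnorm (T u) \<le> C * qnorm u" using assms unfolding LZ2_def by blast
  have "qnorm (T u) \<le> (\<bar>C\<bar> + 1) * qnorm u" if u: "u \<in> Z2" for u
    using C[OF u] qnorm_nonneg[OF u] by (smt (verit) mult_right_mono)
  then show ?thesis using that[of "\<bar>C\<bar> + 1"] by auto
qed

lemma LZ2_zero_pair: "T \<in> LZ2 \<Longrightarrow> T zero_pair = zero_pair"
  using LZ2D(4)[of T zero_pair 0] zero_pair_Z2 by (simp add: scale_pair_def zero_pair_def)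

lemma pair_algebra:
  "add_pair zero_pair zero_pair = zero_pair" "scale_pair a zero_pair = zero_pair"
  "scale_pair a (add_pair u v) = add_pair (scale_pair a u) (scale_pair a v)"
  "scale_pair a (scale_pair b u) = scale_pair b (scale_pair a u)"
  "add_pair (add_pair u v) (add_pair u' v') = add_pair (add_pair u u') (add_pair v v')"
  by (simp_all add: add_pair_def scale_pair_def zero_pair_def algebra_simps)

lemma qnorm_zero_pair: "qnorm zero_pair = 0"
  by (simp add: zero_pair_def qnorm_fst norm2_zero)

lemma LZ2_zero: "(\<lambda>u. zero_pair) \<in> LZ2"
  by (rule LZ2I[where C=0]) (simp_all add: zero_pair_Z2 pair_algebra qnorm_zero_pair)

lemma LZ2_comp:
  assumes "A \<in> LZ2" "B \<in> LZ2"
  shows "A \<circ> B \<in> LZ2"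
proof -
  obtain C where C: "C > 0" "\<And>u. u \<in> Z2 \<Longrightarrow> qnorm (A u) \<le> C * qnorm u" using LZ2_bound[OF assms(1)] by metis
  obtain D where D: "D > 0" "\<And>u. u \<in> Z2 \<Longrightarrow> qnorm (B u) \<le> D * qnorm u" using LZ2_bound[OF assms(2)] by metis
  have "qnorm (A (B u)) \<le> (C * D) * qnorm u" if u: "u \<in> Z2" for u
    using order_trans[OF C(2)[OF LZ2D(1)[OF assms(2) u]] mult_left_mono[OF D(2)[OF u], of C]] C(1)
    by (simp add: mult.assoc)
  then show ?thesis
    by (intro LZ2I[where C="C * D"]) (auto simp: LZ2D[OF assms(1)] LZ2D[OF assms(2)] LZ2_zero_pair[OF assms(1)])
qed

lemma LZ2_add_op:
  assumes "A \<in> LZ2" "B \<in> LZ2"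
  shows "add_op A B \<in> LZ2"
proof -
  obtain C where C: "C > 0" "\<And>u. u \<in> Z2 \<Longrightarrow> qnorm (A u) \<le> C * qnorm u" using LZ2_bound[OF assms(1)] by metis
  obtain D where D: "D > 0" "\<And>u. u \<in> Z2 \<Longrightarrow> qnorm (B u) \<le> D * qnorm u" using LZ2_bound[OF assms(2)] by metis
  have "qnorm (add_pair (A u) (B u)) \<le> (7 * (C + D)) * qnorm u" if u: "u \<in> Z2" for u
    using Z2_add(2)[OF LZ2D(1)[OF assms(1) u] LZ2D(1)[OF assms(2) u]] C(2)[OF u] D(2)[OF u]
    by (simp add: algebra_simps)
  then show ?thesis
    by (intro LZ2I[where C="7 * (C + D)"])
      (simp_all add: LZ2D[OF assms(1)] LZ2D[OF assms(2)] Z2_add add_op_def pair_algebra)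
qed

lemma LZ2_scale_op:
  assumes "A \<in> LZ2"
  shows "scale_op a A \<in> LZ2"
proof -
  obtain C where C: "C > 0" "\<And>u. u \<in> Z2 \<Longrightarrow> qnorm (A u) \<le> C * qnorm u" using LZ2_bound[OF assms(1)] by metis
  have "qnorm (scale_pair a (A u)) \<le> (norm a * C) * qnorm u" if u: "u \<in> Z2" for u
    using Z2_scale(2)[OF LZ2D(1)[OF assms(1) u], of a] mult_left_mono[OF C(2)[OF u], of "norm a"]
    by (simp add: mult.assoc)
  then show ?thesis
    by (intro LZ2I[where C="norm a * C"])
      (simp_all add: LZ2D[OF assms(1)] Z2_scale scale_op_def pair_algebra(2,3) pair_algebra(4)[of a])
qed

section \<open>Finite linear combinations and unit vectors\<close>

definition lincomb :: "'a set \<Rightarrow> ('a \<Rightarrow> 'k::real_or_complex) \<Rightarrow> ('a \<Rightarrow> 'k seq_pair) \<Rightarrow> 'k seq_pair" where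
  "lincomb A c u = (\<lambda>n. \<Sum>a\<in>A. c a * fst (u a) n, \<lambda>n. \<Sum>a\<in>A. c a * snd (u a) n)"

lemma lincomb_insert:
  assumes "finite A" "a \<notin> A"
  shows "lincomb (insert a A) c u = add_pair (scale_pair (c a) (u a)) (lincomb A c u)"
  using assms by (simp add: lincomb_def add_pair_def scale_pair_def)

lemma lincomb_Z2:
  assumes "finite A" "\<And>a. a \<in> A \<Longrightarrow> u a \<in> Z2"
  shows "lincomb A c u \<in> Z2"
  using assms
proof (induction A)
  case empty
  show ?case using zero_pair_Z2 by (simp add: lincomb_def zero_pair_def)
next
  case (insert a A)
  then show ?case by (simp add: lincomb_insert Z2_add Z2_scale)
qed

lemma LZ2_lincomb:
  assumes "T \<in> LZ2" "finite A" "\<And>a. a \<in> A \<Longrightarrow> u a \<in> Z2"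
  shows "T (lincomb A c u) = lincomb A c (\<lambda>a. T (u a))"
  using assms(2,3)
proof (induction A)
  case empty
  show ?case using LZ2_zero_pair[OF assms(1)] by (simp add: lincomb_def zero_pair_def)
next
  case (insert a A)
  then show ?case by (simp add: lincomb_insert Z2_scale LZ2D[OF assms(1)] lincomb_Z2)
qed

lemma unit_seq_ell2: "unit_seq n \<in> ell2" and norm2_unit_seq: "norm2 (unit_seq n) = 1"
  using ell2_finite[of "{n}" "unit_seq n"] by (auto simp: unit_seq_def)

lemma unit_seq_Z2: "(unit_seq n, \<lambda>_. 0) \<in> Z2"
  by (simp add: Z2_fst unit_seq_ell2)

lemma Omega_unit_seq: "Omega (unit_seq n) = (\<lambda>_. 0)"
  by (rule ext) (simp add: Omega_apply norm2_unit_seq, simp add: unit_seq_def)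

lemma unit_seq_Z2_snd: "(\<lambda>_. 0, unit_seq n) \<in> Z2"
  using Z2_Omega[OF unit_seq_ell2, of n] by (simp add: Omega_unit_seq)

section \<open>Diagonal operators\<close>

definition diag_op :: "((nat \<Rightarrow> 'k) \<Rightarrow> (nat \<Rightarrow> 'k)) \<Rightarrow> 'k::real_or_complex pair_op" where
  "diag_op \<alpha> u = (if u \<in> Z2 then (\<alpha> (fst u), \<alpha> (snd u)) else zero_pair)"

text \<open>The identity \<open>\<alpha> x - Omega (\<alpha> y) = \<alpha> (x - Omega y) - (Omega
  (\<alpha> y) - \<alpha> (Omega y))\<close> reduces boundedness to that of \<alpha> on
  \<open>ell2\<close> and of its commutator with \<open>Omega\<close>. Additivity is assumed on all
  sequences because \<open>Omega y\<close> may lie outside \<open>ell2\<close>.\<close>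

lemma diag_op_LZ2:
  assumes add: "\<And>x y. \<alpha> (\<lambda>n. x n + y n) = (\<lambda>n. \<alpha> x n + \<alpha> y n)"
    and scale: "\<And>a x. \<alpha> (\<lambda>n. a * x n) = (\<lambda>n. a * \<alpha> x n)"
    and bound: "\<And>x. x \<in> ell2 \<Longrightarrow> \<alpha> x \<in> ell2 \<and> norm2 (\<alpha> x) \<le> c * norm2 x"
    and comm: "\<And>y. y \<in> ell2 \<Longrightarrow> (\<lambda>p. Omega (\<alpha> y) p - \<alpha> (Omega y) p) \<in> ell2 \<and>
        norm2 (\<lambda>p. Omega (\<alpha> y) p - \<alpha> (Omega y) p) \<le> d * norm2 y"
    and cd: "c \<ge> 0" "d \<ge> 0"
  shows "diag_op \<alpha> \<in> LZ2"
proof -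
  have main: "diag_op \<alpha> u \<in> Z2 \<and> qnorm (diag_op \<alpha> u) \<le> (2 * c + d) * qnorm u" if "u \<in> Z2" for u
  proof -
    obtain x y where u: "u = (x, y)" by (cases u)
    have y: "y \<in> ell2" and x: "(\<lambda>n. x n - Omega y n) \<in> ell2" using that by (auto simp: u Z2_iff)
    have "\<alpha> (\<lambda>n. (x n - Omega y n) + Omega y n) = (\<lambda>n. \<alpha> (\<lambda>n. x n - Omega y n) n + \<alpha> (Omega y) n)"
      by (rule add)
    then have "\<alpha> x = (\<lambda>n. \<alpha> (\<lambda>n. x n - Omega y n) n + \<alpha> (Omega y) n)" by simp
    then have eq: "(\<lambda>n. \<alpha> x n - Omega (\<alpha> y) n) =
        (\<lambda>n. \<alpha> (\<lambda>n. x n - Omega y n) n - (Omega (\<alpha> y) n - \<alpha> (Omega y) n))"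
      by (simp add: fun_eq_iff algebra_simps)
    note dd = ell2_diff[OF conjunct1[OF bound[OF x]] conjunct1[OF comm[OF y]]]
    have nn: "0 \<le> norm2 y" "0 \<le> norm2 (\<lambda>n. x n - Omega y n)" using x y norm2_nonneg by auto
    have "norm2 (\<lambda>n. \<alpha> x n - Omega (\<alpha> y) n) \<le> c * norm2 (\<lambda>n. x n - Omega y n) + d * norm2 y"
      unfolding eq using dd(2) bound[OF x] comm[OF y] by simp
    moreover have "0 \<le> c * norm2 (\<lambda>n. x n - Omega y n)" "0 \<le> d * norm2 (\<lambda>n. x n - Omega y n)"
      "0 \<le> c * norm2 y" using nn cd by simp_all
    ultimately have "qnorm (\<alpha> x, \<alpha> y) \<le> (2 * c + d) * qnorm u"
      using bound[OF y] by (simp add: qnorm_Pair u algebra_simps)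
    moreover have "(\<alpha> x, \<alpha> y) \<in> Z2" using dd(1) bound[OF y] by (simp add: Z2_iff eq)
    ultimately show ?thesis using that by (simp add: diag_op_def u)
  qed
  show ?thesis
    by (rule LZ2I[where C="2 * c + d"])
      (use main in \<open>auto simp: diag_op_def add_pair_def scale_pair_def add scale
        dest: Z2_add(1) Z2_scale(1) simp: Z2_add(1)[unfolded add_pair_def] Z2_scale(1)[unfolded scale_pair_def]\<close>)
qed

lemma diag_op_add:
  "diag_op (\<lambda>x p. \<alpha> x p + \<beta> x p) = add_op (diag_op \<alpha>) (diag_op \<beta>)"
  by (rule ext) (simp add: diag_op_def add_op_def add_pair_def zero_pair_def)

lemma diag_op_sum_LZ2:
  fixes \<alpha> :: "'a \<Rightarrow> (nat \<Rightarrow> 'k::real_or_complex) \<Rightarrow> nat \<Rightarrow> 'k"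
  assumes "finite I" "\<And>i. i \<in> I \<Longrightarrow> diag_op (\<alpha> i) \<in> LZ2"
  shows "diag_op (\<lambda>x p. \<Sum>i\<in>I. \<alpha> i x p) \<in> LZ2"
  using assms
proof (induction I)
  case empty
  have "diag_op (\<lambda>(x :: nat \<Rightarrow> 'k) p. 0) = (\<lambda>u. zero_pair)" by (rule ext) (simp add: diag_op_def zero_pair_def)
  then show ?case using LZ2_zero by simp
next
  case (insert i I)
  then show ?case by (simp add: diag_op_add LZ2_add_op)
qed

section \<open>Weighted compositions, which commute with \<open>Omega\<close> up to a bounded
  error\<close>

definition wcomp :: "(nat \<Rightarrow> real) \<Rightarrow> (nat \<Rightarrow> nat) \<Rightarrow> (nat \<Rightarrow> 'k) \<Rightarrow> nat \<Rightarrow> 'k::real_or_complex" where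
  "wcomp w \<sigma> x p = of_real (w p) * x (\<sigma> p)"

text \<open>Injectivity on the support of \<open>w\<close> makes each entry of \<open>x\<close>
  count at most once.\<close>

lemma wcomp_bound:
  fixes x :: "nat \<Rightarrow> 'k::real_or_complex"
  assumes w: "\<And>p. \<bar>w p\<bar> \<le> 1" and inj: "inj_on \<sigma> {p. w p \<noteq> 0}" and x: "x \<in> ell2"
  shows "wcomp w \<sigma> x \<in> ell2" and "norm2 (wcomp w \<sigma> x) \<le> norm2 x"
proof -
  have "L2_set (\<lambda>p. norm (wcomp w \<sigma> x p)) {..<n} \<le> norm2 x" for n
  proof -
    let ?F = "{p\<in>{..<n}. w p \<noteq> 0}"
    have "(\<Sum>p<n. (norm (wcomp w \<sigma> x p))\<^sup>2) = (\<Sum>p\<in>?F. (norm (wcomp w \<sigma> x p))\<^sup>2)"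
      by (rule sum.mono_neutral_right) (auto simp: wcomp_def)
    also have "\<dots> \<le> (\<Sum>p\<in>?F. (norm (x (\<sigma> p)))\<^sup>2)"
      by (intro sum_mono power_mono) (auto simp: wcomp_def norm_mult intro!: mult_left_le_one_le w)
    also have "\<dots> = (\<Sum>q\<in>\<sigma> ` ?F. (norm (x q))\<^sup>2)"
      by (subst sum.reindex) (auto intro: inj_on_subset[OF inj])
    finally have "L2_set (\<lambda>p. norm (wcomp w \<sigma> x p)) {..<n} \<le> L2_set (\<lambda>q. norm (x q)) (\<sigma> ` ?F)"
      unfolding L2_set_def by (rule real_sqrt_le_mono)
    also have "\<dots> \<le> norm2 x" by (rule L2_set_le_norm2[OF x]) simp
    finally show ?thesis .
  qed
  from ell2_bounded[OF this] show "wcomp w \<sigma> x \<in> ell2" "norm2 (wcomp w \<sigma> x) \<le> norm2 x" by auto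
qed

text \<open>The logarithm of a product splits. The part from \<open>y (\<sigma> p)\<close>
  reproduces \<open>wcomp w \<sigma> (Omega y)\<close>, the part from \<open>w p\<close> is a
  composition with the weight \<open>w'\<close>, again of modulus at most 1, and the change of
  normalisation costs another \<open>norm2 y\<close>.\<close>

lemma wcomp_commutator:
  fixes y :: "nat \<Rightarrow> 'k::real_or_complex"
  assumes w: "\<And>p. \<bar>w p\<bar> \<le> 1" and inj: "inj_on \<sigma> {p. w p \<noteq> 0}" and y: "y \<in> ell2"
  shows "(\<lambda>p. Omega (wcomp w \<sigma> y) p - wcomp w \<sigma> (Omega y) p) \<in> ell2 \<and>
    norm2 (\<lambda>p. Omega (wcomp w \<sigma> y) p - wcomp w \<sigma> (Omega y) p) \<le> 2 * norm2 y"
proof (cases "norm2 y = 0")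
  case True
  then have "y = (\<lambda>n. 0)" using norm2_eq_0[OF y] by simp
  moreover have "wcomp w \<sigma> (\<lambda>n. 0 :: 'k) = (\<lambda>n. 0)" by (simp add: wcomp_def fun_eq_iff)
  ultimately show ?thesis by (simp add: Omega_zero ell2_zero norm2_zero)
next
  case False
  define s where "s = norm2 y"
  have s: "s > 0" using False norm2_nonneg[OF y] s_def by simp
  note b = wcomp_bound[OF w inj y]
  define w' where "w' p = w p * ln (1 / \<bar>w p\<bar>)" for p
  have w': "\<bar>w' p\<bar> \<le> 1" for p using mult_abs_ln_le[of "\<bar>w p\<bar>" 1] w[of p] by (simp add: w'_def abs_mult)
  have inj': "inj_on \<sigma> {p. w' p \<noteq> 0}" by (rule inj_on_subset[OF inj]) (auto simp: w'_def)
  note b' = wcomp_bound[OF w' inj' y]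
  let ?z = "wcomp w \<sigma> y"
  let ?E = "\<lambda>p. ?z p * of_real (ln (s / norm2 ?z))"
  note e = ell2_scale_ln[OF b(1), of s, unfolded s_def, OF b(2), folded s_def]
  have "Omega ?z p - wcomp w \<sigma> (Omega y) p = wcomp w' \<sigma> y p - ?E p" for p
  proof (cases "w p = 0 \<or> y (\<sigma> p) = 0")
    case True
    then show ?thesis by (auto simp: Omega_apply wcomp_def w'_def)
  next
    case False
    then have "ln (s / norm (?z p)) = ln (1 / \<bar>w p\<bar>) + ln (s / norm (y (\<sigma> p)))"
      using s by (simp add: wcomp_def norm_mult ln_div ln_mult)
    then have "?z p * of_real (ln (s / norm (?z p))) = wcomp w' \<sigma> y p + wcomp w \<sigma> (Omega y) p"
      by (simp add: wcomp_def w'_def Omega_apply flip: s_def) (simp add: algebra_simps)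
    with Omega_rescale[OF b(1) s, of p] show ?thesis by simp
  qed
  then have eq: "(\<lambda>p. Omega ?z p - wcomp w \<sigma> (Omega y) p) = (\<lambda>p. wcomp w' \<sigma> y p - ?E p)" by simp
  show ?thesis unfolding eq using ell2_diff[OF b'(1) e(1)] b'(2) e(2) by (auto simp: s_def)
qed

lemma wcomp_LZ2:
  assumes "\<And>p. \<bar>w p\<bar> \<le> 1" "inj_on \<sigma> {p. w p \<noteq> 0}"
  shows "diag_op (wcomp w \<sigma>) \<in> LZ2"
  by (rule diag_op_LZ2[where c=1 and d=2])
    (use wcomp_bound[OF assms] wcomp_commutator[OF assms] in \<open>auto simp: wcomp_def algebra_simps\<close>)

section \<open>Hadamard matrices\<close>

text \<open>Sylvester's matrices: the matrix of size \<open>2 ^ k\<close> is the upper left corner of \<open>hadamard\<close>.\<close>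

fun hadamard :: "nat \<Rightarrow> nat \<Rightarrow> real" where
  "hadamard i j = (if i = 0 \<or> j = 0 then 1
     else (if odd i \<and> odd j then -1 else 1) * hadamard (i div 2) (j div 2))"

declare hadamard.simps [simp del]

lemma abs_hadamard: "\<bar>hadamard i j\<bar> = 1"
  by (induction i j rule: hadamard.induct) (subst hadamard.simps, simp add: abs_mult)

lemma hadamard_commute: "hadamard i j = hadamard j i"
proof (induction i j rule: hadamard.induct)
  case (1 i j)
  then show ?case by (subst (1 2) hadamard.simps) auto
qed

text \<open>Zero indices obey the recursion as well, since 0 is even and \<open>0 div 2 = 0\<close>.
  This form has no exceptional case.\<close>

lemma hadamard_rec: "hadamard i j = (if odd i \<and> odd j then -1 else 1) * hadamard (i div 2) (j div 2)"
  by (subst hadamard.simps) (auto simp: hadamard.simps[of 0] hadamard.simps[of _ 0])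

text \<open>Splitting \<open>l\<close> by its last binary digit leaves the sum for size
  \<open>2 ^ k\<close> times a factor 0 or 2. Distinct indices with equal halves differ in parity,
  and then the factor is 0.\<close>

lemma hadamard_orthogonal:
  assumes "i < 2 ^ k" "j < 2 ^ k"
  shows "(\<Sum>l<2 ^ k. hadamard l i * hadamard l j) = (if i = j then 2 ^ k else 0)"
  using assms
proof (induction k arbitrary: i j)
  case 0
  then show ?case by (simp add: hadamard.simps)
next
  case (Suc k)
  have lt: "i div 2 < 2 ^ k" "j div 2 < 2 ^ k" using Suc.prems by auto
  have split: "(\<Sum>l<2 * n. f l) = (\<Sum>l<n. f (2 * l) + f (2 * l + 1))" for f :: "nat \<Rightarrow> real" and n
    by (induction n) auto
  have "(\<Sum>l<2 ^ Suc k. hadamard l i * hadamard l j) =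
      (\<Sum>l<2 ^ k. hadamard (2 * l) i * hadamard (2 * l) j + hadamard (2 * l + 1) i * hadamard (2 * l + 1) j)"
    by (simp add: split)
  also have "\<dots> = (\<Sum>l<2 ^ k. (1 + (if odd i then -1 else 1) * (if odd j then -1 else 1)) *
      (hadamard l (i div 2) * hadamard l (j div 2)))"
    by (intro sum.cong refl, subst (1 2 3 4) hadamard_rec) (simp add: algebra_simps)
  also have "\<dots> = (1 + (if odd i then -1 else 1) * (if odd j then -1 else 1)) *
      (if i div 2 = j div 2 then 2 ^ k else 0)"
    by (simp only: sum_distrib_left[symmetric] Suc.IH[OF lt])
  also have "\<dots> = (if i = j then 2 ^ Suc k else 0)"
  proof (cases "i = j")
    case False
    then have "i div 2 \<noteq> j div 2 \<or> odd i \<noteq> odd j" by (metis bit_eq_rec even_iff_mod_2_eq_zero)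
    then show ?thesis using False by auto
  qed auto
  finally show ?case .
qed

definition walsh :: "nat \<Rightarrow> nat \<Rightarrow> nat \<Rightarrow> real" where
  "walsh k i j = hadamard i j / sqrt (2 ^ k)"

lemma abs_walsh: "\<bar>walsh k i j\<bar> = 1 / sqrt (2 ^ k)"
  by (simp add: walsh_def abs_hadamard)

lemma walsh_commute: "walsh k i j = walsh k j i"
  by (simp add: walsh_def hadamard_commute)

lemma walsh_orthogonal:
  assumes "i < 2 ^ k" "j < 2 ^ k"
  shows "(\<Sum>l<2 ^ k. walsh k l i * walsh k l j) = (if i = j then 1 else 0)"
proof -
  have "(\<Sum>l<2 ^ k. walsh k l i * walsh k l j) = (\<Sum>l<2 ^ k. hadamard l i * hadamard l j) / 2 ^ k"
    by (simp add: walsh_def sum_divide_distrib)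
  then show ?thesis using hadamard_orthogonal[OF assms] by simp
qed

text \<open>The class axiom determines \<open>x * conjugate x\<close>; cancelling the factor
  \<open>of_real r\<close>, if nonzero, determines the conjugate.\<close>

lemma conjugate_of_real: "conjugate (of_real r :: 'k::real_or_complex) = of_real r"
proof (cases "r = 0")
  case False
  have "(of_real r :: 'k) * conjugate (of_real r) = of_real r * of_real r"
    using mult_conjugate_self[of "of_real r :: 'k"] by (simp add: power2_eq_square of_real_def)
  then show ?thesis using False by simp
qed simp

lemma walsh_parseval:
  fixes x :: "nat \<Rightarrow> 'k::real_or_complex"
  shows "(\<Sum>i<2 ^ k. (norm (\<Sum>l<2 ^ k. of_real (walsh k i l) * x l))\<^sup>2) = (\<Sum>l<2 ^ k. (norm (x l))\<^sup>2)"
proof -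
  have sq: "of_real ((norm z)\<^sup>2) = z * conjugate z" for z :: 'k
    by (simp only: mult_conjugate_self of_real_def)
  have "of_real (\<Sum>i<2 ^ k. (norm (\<Sum>l<2 ^ k. of_real (walsh k i l) * x l))\<^sup>2) =
      (\<Sum>i<2 ^ k. (\<Sum>l<2 ^ k. of_real (walsh k i l) * x l) * (\<Sum>m<2 ^ k. of_real (walsh k i m) * conjugate (x m)))"
    by (simp only: of_real_sum sq sum_conjugate[OF finite_lessThan] conjugate_dist_mul conjugate_of_real)
  also have "\<dots> = (\<Sum>i<2 ^ k. \<Sum>l<2 ^ k. \<Sum>m<2 ^ k. of_real (walsh k i l * walsh k i m) * (x l * conjugate (x m)))"
    by (simp add: sum_product mult_ac)
  also have "\<dots> = (\<Sum>l<2 ^ k. \<Sum>i<2 ^ k. \<Sum>m<2 ^ k. of_real (walsh k i l * walsh k i m) * (x l * conjugate (x m)))"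
    by (rule sum.swap)
  also have "\<dots> = (\<Sum>l<2 ^ k. \<Sum>m<2 ^ k. \<Sum>i<2 ^ k. of_real (walsh k i l * walsh k i m) * (x l * conjugate (x m)))"
    by (intro sum.cong refl sum.swap)
  also have "\<dots> = (\<Sum>l<2 ^ k. \<Sum>m<2 ^ k. of_real (\<Sum>i<2 ^ k. walsh k i l * walsh k i m) * (x l * conjugate (x m)))"
    by (simp only: of_real_sum sum_distrib_right)
  also have "\<dots> = (\<Sum>l<2 ^ k. \<Sum>m<2 ^ k. if l = m then x l * conjugate (x m) else 0)"
    by (intro sum.cong refl) (simp add: walsh_orthogonal)
  also have "\<dots> = (\<Sum>l<2 ^ k. x l * conjugate (x l))"
    by (intro sum.cong refl) simp
  also have "\<dots> = of_real (\<Sum>l<2 ^ k. (norm (x l))\<^sup>2)"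
    by (simp only: of_real_sum sq)
  finally show ?thesis by (simp only: of_real_eq_iff)
qed

section \<open>Pairing with the symplectic form\<close>

text \<open>Apply \<open>ln s \<le> s\<close> to \<open>a / b\<close> and to its reciprocal.\<close>

lemma mult_mult_abs_ln_le:
  fixes a b :: real
  assumes "a > 0" "b > 0"
  shows "a * b * \<bar>ln (a / b)\<bar> \<le> a\<^sup>2 + b\<^sup>2"
proof -
  have "ln (a / b) \<le> a / b" using assms ln_bound[of "a / b"] by simp
  then have 1: "a * b * ln (a / b) \<le> a * b * (a / b)" using assms by (intro mult_left_mono) auto
  have "ln (b / a) \<le> b / a" using assms ln_bound[of "b / a"] by simp
  then have 2: "a * b * ln (b / a) \<le> a * b * (b / a)" using assms by (intro mult_left_mono) auto
  have "ln (b / a) = - ln (a / b)" using assms by (simp add: ln_div)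
  moreover have "a * b * (a / b) = a\<^sup>2" "a * b * (b / a) = b\<^sup>2" using assms by (auto simp: power2_eq_square)
  ultimately have "a * b * ln (a / b) \<le> a\<^sup>2" "a * b * (- ln (a / b)) \<le> b\<^sup>2" using 1 2 by auto
  moreover have "a * b * \<bar>ln (a / b)\<bar> = \<bar>a * b * ln (a / b)\<bar>" using assms by (simp add: abs_mult)
  ultimately show ?thesis using zero_le_power2[of a] zero_le_power2[of b] by linarith
qed

text \<open>Continuity of the symplectic form against \<open>(Omega z, z)\<close>, in bilinear form
  without conjugation. Cauchy-Schwarz handles \<open>x - Omega y\<close>. In the remainder the two
  logarithms combine into that of \<open>(s * norm (z q)) / (t * norm (y q))\<close>, so that
  \<open>mult_mult_abs_ln_le\<close> applies.\<close>

lemma pairing_bound: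
  fixes x y z :: "nat \<Rightarrow> 'k::real_or_complex"
  assumes xy: "(x, y) \<in> Z2" and F: "finite F" "\<And>q. q \<notin> F \<Longrightarrow> z q = 0"
  shows "norm (\<Sum>q\<in>F. z q * x q - Omega z q * y q) \<le> 2 * qnorm (x, y) * norm2 z"
proof -
  have y: "y \<in> ell2" and x: "(\<lambda>n. x n - Omega y n) \<in> ell2" using xy by (auto simp: Z2_iff)
  note z = ell2_finite[of F z, OF F]
  define s where "s = norm2 y"
  define t where "t = norm2 z"
  have s0: "s \<ge> 0" and t0: "t \<ge> 0" using norm2_nonneg y z(1) by (auto simp: s_def t_def)
  have "norm (\<Sum>q\<in>F. z q * (x q - Omega y q)) \<le> (\<Sum>q\<in>F. \<bar>norm (z q)\<bar> * \<bar>norm (x q - Omega y q)\<bar>)"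
    by (rule order_trans[OF norm_sum]) (simp add: norm_mult)
  also have "\<dots> \<le> L2_set (\<lambda>q. norm (z q)) F * L2_set (\<lambda>q. norm (x q - Omega y q)) F"
    by (rule L2_set_mult_ineq)
  also have "\<dots> \<le> t * norm2 (\<lambda>q. x q - Omega y q)"
    using L2_set_le_norm2[OF x F(1)] t0 by (simp add: t_def z(2) mult_left_mono)
  finally have A: "norm (\<Sum>q\<in>F. z q * (x q - Omega y q)) \<le> t * norm2 (\<lambda>q. x q - Omega y q)" .
  have B: "norm (\<Sum>q\<in>F. z q * Omega y q - Omega z q * y q) \<le> 2 * s * t"
  proof (cases "s = 0 \<or> t = 0")
    case True
    then have "y = (\<lambda>n. 0) \<or> z = (\<lambda>n. 0)" using norm2_eq_0 y z(1) by (auto simp: s_def t_def)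
    then have "(\<Sum>q\<in>F. z q * Omega y q - Omega z q * y q) = 0" by (auto simp: Omega_zero)
    then show ?thesis using s0 t0 by simp
  next
    case False
    then have s: "s > 0" and t: "t > 0" using s0 t0 by auto
    have pointwise: "s * t * norm (z q * Omega y q - Omega z q * y q) \<le> (s * norm (z q))\<^sup>2 + (t * norm (y q))\<^sup>2" for q
    proof (cases "z q = 0 \<or> y q = 0")
      case True
      then show ?thesis by (auto simp: Omega_apply)
    next
      case False
      let ?a = "s * norm (z q)" and ?b = "t * norm (y q)"
      have ab: "?a > 0" "?b > 0" using False s t by auto
      have "ln (s / norm (y q)) - ln (t / norm (z q)) = ln (?a / ?b)"
        using False s t by (simp add: ln_div ln_mult)
      moreover have "z q * Omega y q - Omega z q * y q =
          z q * y q * of_real (ln (s / norm (y q)) - ln (t / norm (z q)))"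
        by (simp add: Omega_apply s_def t_def algebra_simps)
      ultimately have "norm (z q * Omega y q - Omega z q * y q) = norm (z q) * norm (y q) * \<bar>ln (?a / ?b)\<bar>"
        by (simp add: norm_mult)
      then show ?thesis using mult_mult_abs_ln_le[OF ab] by (simp add: mult_ac)
    qed
    have sq: "(\<Sum>q\<in>F. (norm (u q))\<^sup>2) \<le> (norm2 u)\<^sup>2" if "u \<in> ell2" for u :: "nat \<Rightarrow> 'k"
      using power_mono[OF L2_set_le_norm2[OF that F(1)], of 2] by (simp add: L2_set_def sum_nonneg)
    have "s * t * norm (\<Sum>q\<in>F. z q * Omega y q - Omega z q * y q)
        \<le> s * t * (\<Sum>q\<in>F. norm (z q * Omega y q - Omega z q * y q))"
      using s t by (intro mult_left_mono norm_sum) auto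
    also have "\<dots> \<le> (\<Sum>q\<in>F. (s * norm (z q))\<^sup>2 + (t * norm (y q))\<^sup>2)"
      unfolding sum_distrib_left by (intro sum_mono pointwise)
    also have "\<dots> = s\<^sup>2 * (\<Sum>q\<in>F. (norm (z q))\<^sup>2) + t\<^sup>2 * (\<Sum>q\<in>F. (norm (y q))\<^sup>2)"
      by (simp add: power_mult_distrib sum.distrib sum_distrib_left)
    also have "\<dots> \<le> s\<^sup>2 * t\<^sup>2 + t\<^sup>2 * s\<^sup>2"
      unfolding s_def t_def by (intro add_mono mult_left_mono sq y z(1)) auto
    also have "\<dots> = s * t * (2 * s * t)" by (simp add: power2_eq_square)
    finally show ?thesis using s t by (simp del: mult.assoc)
  qed
  have "(\<Sum>q\<in>F. z q * x q - Omega z q * y q) =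
      (\<Sum>q\<in>F. z q * (x q - Omega y q)) + (\<Sum>q\<in>F. z q * Omega y q - Omega z q * y q)"
    by (simp add: sum.distrib[symmetric] algebra_simps)
  also have "norm \<dots> \<le> t * norm2 (\<lambda>q. x q - Omega y q) + 2 * s * t"
    using norm_triangle_ineq A B by (rule order_trans[OF _ add_mono])
  also have "\<dots> \<le> 2 * qnorm (x, y) * norm2 z"
    using mult_nonneg_nonneg[OF t0 norm2_nonneg[OF x]]
    by (simp add: qnorm_Pair flip: s_def t_def) (simp add: algebra_simps)
  finally show ?thesis .
qed

section \<open>Finitely supported sequences\<close>

text \<open>The map \<open>pos\<close> allows index sets of any type, such as pairs, to be placed
  among the natural numbers.\<close>

definition embed_seq :: "'a set \<Rightarrow> ('a \<Rightarrow> nat) \<Rightarrow> ('a \<Rightarrow> 'k) \<Rightarrow> nat \<Rightarrow> 'k::real_or_complex" where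
  "embed_seq P pos t = (\<lambda>n. \<Sum>p\<in>P. t p * unit_seq (pos p) n)"

lemma embed_pos:
  assumes "finite P" "inj_on pos P" "p \<in> P"
  shows "embed_seq P pos t (pos p) = t p"
proof -
  have "embed_seq P pos t (pos p) = (\<Sum>q\<in>P. if q = p then t q else 0)"
    unfolding embed_seq_def using assms(2,3)
    by (intro sum.cong refl) (auto simp: unit_seq_def inj_on_def)
  then show ?thesis using assms by simp
qed

lemma embed_outside: "n \<notin> pos ` P \<Longrightarrow> embed_seq P pos t n = 0"
  by (auto simp: embed_seq_def unit_seq_def intro!: sum.neutral)

lemma embed_ell2:
  assumes "finite P" "inj_on pos P"
  shows "embed_seq P pos t \<in> ell2" and "norm2 (embed_seq P pos t) = L2_set (\<lambda>p. norm (t p)) P"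
proof -
  note e = ell2_finite[of "pos ` P" "embed_seq P pos t", OF _ embed_outside]
  show "embed_seq P pos t \<in> ell2" using e(1) assms by simp
  have "norm2 (embed_seq P pos t) = L2_set (\<lambda>n. norm (embed_seq P pos t n)) (pos ` P)" using e(2) assms by simp
  also have "\<dots> = L2_set (\<lambda>p. norm (t p)) P"
    unfolding L2_set_def using assms by (simp add: sum.reindex embed_pos)
  finally show "norm2 (embed_seq P pos t) = L2_set (\<lambda>p. norm (t p)) P" .
qed

text \<open>Unit vectors on which \<open>Omega\<close> is multiplication by \<kappa>: all nonzero
  entries share one modulus, so the logarithm is constant.\<close>

definition flat :: "'a set \<Rightarrow> real \<Rightarrow> ('a \<Rightarrow> real) \<Rightarrow> bool" where
  "flat P \<kappa> y \<longleftrightarrow> (\<Sum>p\<in>P. (y p)\<^sup>2) = 1 \<and> (\<forall>p\<in>P. y p = 0 \<or> \<bar>y p\<bar> = exp (- \<kappa>))"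

lemma flat_embed:
  assumes P: "finite P" "inj_on pos P" and y: "flat P \<kappa> y"
  shows "norm2 (embed_seq P pos (\<lambda>p. of_real (y p)) :: nat \<Rightarrow> 'k::real_or_complex) = 1"
    and "Omega (embed_seq P pos (\<lambda>p. of_real (y p))) =
      (\<lambda>n. of_real \<kappa> * (embed_seq P pos (\<lambda>p. of_real (y p)) n :: 'k))"
proof -
  let ?Y = "embed_seq P pos (\<lambda>p. of_real (y p)) :: nat \<Rightarrow> 'k"
  show 1: "norm2 ?Y = 1" using y by (simp add: embed_ell2[OF P] L2_set_def flat_def)
  show "Omega ?Y = (\<lambda>n. of_real \<kappa> * ?Y n)"
  proof
    fix n
    show "Omega ?Y n = of_real \<kappa> * ?Y n"
    proof (cases "n \<in> pos ` P")
      case False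
      then show ?thesis by (simp add: Omega_apply embed_outside)
    next
      case True
      then obtain p where p: "p \<in> P" "n = pos p" by auto
      have "y p = 0 \<or> \<bar>y p\<bar> = exp (- \<kappa>)" using y p by (simp add: flat_def)
      then show ?thesis using p by (auto simp: Omega_apply 1 embed_pos[OF P] ln_div)
    qed
  qed
qed

section \<open>A trace inequality\<close>

text \<open>Each \<open>b\<close> gives one pairing of size at most \<open>2 * C\<close>. After
  summation the families \<open>y\<close> and \<open>z\<close> enter only through \<open>V\<close>,
  so different families with the same \<open>V\<close> bound different combinations of the same four
  numbers.\<close>

lemma trace_bound:
  fixes B :: "'k::real_or_complex pair_op" and V :: "'a \<Rightarrow> 'a \<Rightarrow> real"
  assumes B: "B \<in> LZ2" and C: "\<And>u. u \<in> Z2 \<Longrightarrow> qnorm (B u) \<le> C * qnorm u"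
    and P: "finite P" "inj_on pos P"
    and y: "\<And>b. b \<in> Q \<Longrightarrow> flat P \<kappa> (y b)" and z: "\<And>b. b \<in> Q \<Longrightarrow> flat P \<mu> (z b)"
    and V: "\<And>p q. p \<in> P \<Longrightarrow> q \<in> P \<Longrightarrow> (\<Sum>b\<in>Q. y b p * z b q) = V p q"
  defines "tr \<equiv> \<lambda>a. \<Sum>p\<in>P. \<Sum>q\<in>P. of_real (V p q) * a p (pos q)"
  shows "norm (of_real \<kappa> * tr (\<lambda>p. fst (B (unit_seq (pos p), \<lambda>_. 0)))
      + tr (\<lambda>p. fst (B (\<lambda>_. 0, unit_seq (pos p))))
      - of_real (\<kappa> * \<mu>) * tr (\<lambda>p. snd (B (unit_seq (pos p), \<lambda>_. 0)))
      - of_real \<mu> * tr (\<lambda>p. snd (B (\<lambda>_. 0, unit_seq (pos p))))) \<le> 2 * C * card Q"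
proof -
  let ?E1 = "\<lambda>p. (unit_seq (pos p), \<lambda>_. 0) :: 'k seq_pair"
  let ?E2 = "\<lambda>p. (\<lambda>_. 0, unit_seq (pos p)) :: 'k seq_pair"
  let ?E = "\<lambda>p. add_pair (scale_pair (of_real \<kappa>) (?E1 p)) (?E2 p)"
  have E: "?E p \<in> Z2" for p by (intro Z2_add Z2_scale unit_seq_Z2 unit_seq_Z2_snd)
  have BE: "B (?E p) = add_pair (scale_pair (of_real \<kappa>) (B (?E1 p))) (B (?E2 p))" for p
    by (simp add: LZ2D[OF B] Z2_scale unit_seq_Z2 unit_seq_Z2_snd)
  let ?g = "\<lambda>p q. fst (B (?E p)) (pos q) - of_real \<mu> * snd (B (?E p)) (pos q)"
  have b: "norm (\<Sum>p\<in>P. \<Sum>q\<in>P. of_real (y b p * z b q) * ?g p q) \<le> 2 * C" if b: "b \<in> Q" for b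
  proof -
    let ?Y = "embed_seq P pos (\<lambda>p. of_real (y b p)) :: nat \<Rightarrow> 'k"
    let ?Z = "embed_seq P pos (\<lambda>p. of_real (z b p)) :: nat \<Rightarrow> 'k"
    let ?u = "lincomb P (\<lambda>p. of_real (y b p)) ?E"
    \<comment> \<open>Flatness puts the combination on the graph of \<open>Omega\<close>, so its
      quasi-norm is 1 however large \<kappa> is.\<close>
    have u: "?u = (Omega ?Y, ?Y)"
      unfolding flat_embed(2)[OF P y[OF b]]
      by (simp add: lincomb_def embed_seq_def add_pair_def scale_pair_def sum_distrib_left mult_ac)
    have uZ: "?u \<in> Z2" unfolding u by (intro Z2_Omega embed_ell2 P)
    have "qnorm ?u = 1" unfolding u qnorm_Omega by (rule flat_embed(1)[OF P y[OF b]])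
    then have qB: "qnorm (B ?u) \<le> C" using C[OF uZ] by simp
    have Bu: "B ?u = lincomb P (\<lambda>p. of_real (y b p)) (\<lambda>p. B (?E p))"
      by (rule LZ2_lincomb[OF B P(1) E])
    have "norm (\<Sum>n\<in>pos ` P. ?Z n * fst (B ?u) n - Omega ?Z n * snd (B ?u) n)
        \<le> 2 * qnorm (fst (B ?u), snd (B ?u)) * norm2 ?Z"
      by (rule pairing_bound) (use LZ2D(1)[OF B uZ] P embed_outside in auto)
    also have "\<dots> \<le> 2 * C" using qB flat_embed(1)[OF P z[OF b], where 'k='k] by simp
    also have "(\<Sum>n\<in>pos ` P. ?Z n * fst (B ?u) n - Omega ?Z n * snd (B ?u) n) =
        (\<Sum>q\<in>P. of_real (z b q) * (fst (B ?u) (pos q) - of_real \<mu> * snd (B ?u) (pos q)))"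
      using P by (simp add: flat_embed(2)[OF P z[OF b]] sum.reindex embed_pos algebra_simps)
    also have "\<dots> = (\<Sum>q\<in>P. \<Sum>p\<in>P. of_real (y b p * z b q) * ?g p q)"
      unfolding Bu by (simp add: lincomb_def sum_distrib_left sum_subtractf algebra_simps)
    also have "\<dots> = (\<Sum>p\<in>P. \<Sum>q\<in>P. of_real (y b p * z b q) * ?g p q)" by (rule sum.swap)
    finally show ?thesis .
  qed
  have "norm (\<Sum>b\<in>Q. \<Sum>p\<in>P. \<Sum>q\<in>P. of_real (y b p * z b q) * ?g p q) \<le> (\<Sum>b\<in>Q. 2 * C)"
    by (rule order_trans[OF norm_sum]) (intro sum_mono b)
  also have "(\<Sum>b\<in>Q. \<Sum>p\<in>P. \<Sum>q\<in>P. of_real (y b p * z b q) * ?g p q) =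
      (\<Sum>p\<in>P. \<Sum>b\<in>Q. \<Sum>q\<in>P. of_real (y b p * z b q) * ?g p q)" by (rule sum.swap)
  also have "\<dots> = (\<Sum>p\<in>P. \<Sum>q\<in>P. \<Sum>b\<in>Q. of_real (y b p * z b q) * ?g p q)"
    by (intro sum.cong refl sum.swap)
  also have "\<dots> = (\<Sum>p\<in>P. \<Sum>q\<in>P. of_real (V p q) * ?g p q)"
    by (simp add: V[symmetric] sum_distrib_right)
  also have "\<dots> = of_real \<kappa> * tr (\<lambda>p. fst (B (?E1 p))) + tr (\<lambda>p. fst (B (?E2 p)))
      - of_real (\<kappa> * \<mu>) * tr (\<lambda>p. snd (B (?E1 p))) - of_real \<mu> * tr (\<lambda>p. snd (B (?E2 p)))"
    unfolding tr_def BE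
    by (simp add: add_pair_def scale_pair_def sum_distrib_left sum_subtractf sum.distrib algebra_simps)
  finally show ?thesis by (simp add: mult.commute)
qed

text \<open>The tensor product of the Walsh matrix with an identity matrix: the first index is a
  position in a block, the second numbers the block.\<close>

definition walsh_id :: "nat \<Rightarrow> nat \<times> nat \<Rightarrow> nat \<times> nat \<Rightarrow> real" where
  "walsh_id k p q = walsh k (fst p) (fst q) * (if snd p = snd q then 1 else 0)"

lemma walsh_exp: "\<bar>walsh k i j\<bar> = exp (- (real k / 2 * ln 2))"
proof -
  have "exp (real k / 2 * ln 2) = sqrt (2 ^ k)"
    by (rule real_sqrt_unique[symmetric])
      (auto simp: power2_eq_square exp_add[symmetric] exp_of_nat_mult)
  then show ?thesis by (simp add: abs_walsh exp_minus inverse_eq_divide)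
qed

text \<open>Three pairs of families produce the same matrix \<open>walsh_id k\<close>: its rows with
  unit vectors, unit vectors with its rows, and rows of identity tensor Walsh with rows of Walsh
  tensor Walsh. Their flatness constants are \<open>(L, 0)\<close>, \<open>(0, L)\<close> and
  \<open>(L, 2 * L)\<close>.\<close>

lemma hadamard_obstruction:
  fixes B :: "'k::real_or_complex pair_op" and k :: nat
  assumes B: "B \<in> LZ2" and C: "\<And>u. u \<in> Z2 \<Longrightarrow> qnorm (B u) \<le> C * qnorm u"
  defines "P \<equiv> {..<2 ^ k} \<times> {..<2 ^ k :: nat}" and "N \<equiv> (2 ^ k) :: real" and "L \<equiv> real k / 2 * ln 2"
  assumes inj: "inj_on pos P"
    and a: "\<And>p q. p \<in> P \<Longrightarrow> q \<in> P \<Longrightarrow>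
      norm (fst (B (unit_seq (pos p), \<lambda>_. 0)) (pos q) - of_real (c * walsh_id k p q)) \<le> \<epsilon>"
    and d: "\<And>p q. p \<in> P \<Longrightarrow> q \<in> P \<Longrightarrow> norm (snd (B (unit_seq (pos p), \<lambda>_. 0)) (pos q)) \<le> \<epsilon>"
  shows "L * (c * N ^ 2 - \<epsilon> * N ^ 4) \<le> 4 * C * N ^ 2 + L ^ 2 * (\<epsilon> * N ^ 4)"
proof -
  have fin: "finite P" by (simp add: P_def)
  have card: "real (card P) = N ^ 2" by (simp add: P_def N_def power2_eq_square)
  have L0: "L \<ge> 0" by (simp add: L_def)
  define tr where "tr a = (\<Sum>p\<in>P. \<Sum>q\<in>P. of_real (walsh_id k p q) * a p (pos q))" for a :: "nat \<times> nat \<Rightarrow> nat \<Rightarrow> 'k"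
  define XA where "XA = tr (\<lambda>p. fst (B (unit_seq (pos p), \<lambda>_. 0)))"
  define XB where "XB = tr (\<lambda>p. fst (B (\<lambda>_. 0, unit_seq (pos p))))"
  define XC where "XC = tr (\<lambda>p. snd (B (unit_seq (pos p), \<lambda>_. 0)))"
  define XD where "XD = tr (\<lambda>p. snd (B (\<lambda>_. 0, unit_seq (pos p))))"
  have bound: "norm (of_real \<kappa> * XA + XB - of_real (\<kappa> * \<mu>) * XC - of_real \<mu> * XD) \<le> 2 * C * N ^ 2"
    if "\<And>b. b \<in> P \<Longrightarrow> flat P \<kappa> (y b)" "\<And>b. b \<in> P \<Longrightarrow> flat P \<mu> (z b)"
      "\<And>p q. p \<in> P \<Longrightarrow> q \<in> P \<Longrightarrow> (\<Sum>b\<in>P. y b p * z b q) = walsh_id k p q" for \<kappa> \<mu> y z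
    using trace_bound[OF B C fin inj, of P \<kappa> y \<mu> z "walsh_id k"] that
    by (simp add: XA_def XB_def XC_def XD_def tr_def card)
  have orth: "(\<Sum>l<2 ^ k. walsh k i l * walsh k j l) = (if i = j then 1 else 0)" if "i < 2 ^ k" "j < 2 ^ k" for i j
    using walsh_orthogonal[OF that] by (simp add: walsh_commute)
  have sumP: "(\<Sum>p\<in>P. f p) = (\<Sum>i<2 ^ k. \<Sum>j<2 ^ k. f (i, j))" for f :: "nat \<times> nat \<Rightarrow> real"
    by (simp add: P_def sum.cartesian_product)
  have sumW: "(\<Sum>q\<in>P. (walsh_id k p q)\<^sup>2) = 1" if "p \<in> P" for p
  proof -
    have "(\<Sum>q\<in>P. (walsh_id k p q)\<^sup>2) =
        (\<Sum>i<2 ^ k. \<Sum>j<2 ^ k. if j = snd p then walsh k (fst p) i * walsh k (fst p) i else 0)"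
      unfolding sumP by (intro sum.cong refl) (simp add: walsh_id_def power2_eq_square)
    also have "\<dots> = 1" using that by (auto simp: P_def orth)
    finally show ?thesis .
  qed
  have fW: "flat P L (walsh_id k b)" if "b \<in> P" for b
    unfolding flat_def using sumW[OF that] by (auto simp: walsh_id_def walsh_exp L_def)
  have f1: "flat P 0 (\<lambda>p. if p = b then 1 else 0)" if "b \<in> P" for b
  proof -
    have "(\<Sum>p\<in>P. (if p = b then 1 else 0 :: real)\<^sup>2) = (\<Sum>p\<in>P. if p = b then 1 else 0)"
      by (intro sum.cong) auto
    then show ?thesis using that fin by (simp add: flat_def)
  qed
  have fU: "flat P L (\<lambda>p. (if fst p = fst b then 1 else 0) * walsh k (snd b) (snd p))" if "b \<in> P" for b
  proof -
    have "(\<Sum>p\<in>P. ((if fst p = fst b then 1 else 0) * walsh k (snd b) (snd p))\<^sup>2) =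
        (\<Sum>i<2 ^ k. if i = fst b then (\<Sum>j<2 ^ k. walsh k (snd b) j * walsh k (snd b) j) else 0)"
      unfolding sumP by (intro sum.cong refl) (simp add: power2_eq_square)
    also have "\<dots> = 1" using that by (auto simp: P_def orth)
    finally show ?thesis by (auto simp: flat_def walsh_exp L_def)
  qed
  have fUW: "flat P (2 * L) (\<lambda>p. walsh k (fst b) (fst p) * walsh k (snd b) (snd p))" if "b \<in> P" for b
  proof -
    have "(\<Sum>p\<in>P. (walsh k (fst b) (fst p) * walsh k (snd b) (snd p))\<^sup>2) =
        (\<Sum>i<2 ^ k. walsh k (fst b) i * walsh k (fst b) i) * (\<Sum>j<2 ^ k. walsh k (snd b) j * walsh k (snd b) j)"
      unfolding sumP sum_product by (intro sum.cong refl) (simp add: power2_eq_square)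
    also have "\<dots> = 1" using that by (auto simp: P_def orth)
    finally show ?thesis by (auto simp: flat_def abs_mult walsh_exp L_def exp_add[symmetric])
  qed
  have sym: "walsh_id k p q = walsh_id k q p" for p q by (simp add: walsh_id_def walsh_commute)
  have "norm (of_real L * XA + XB - of_real (L * 0) * XC - of_real 0 * XD) \<le> 2 * C * N ^ 2"
    by (rule bound[OF fW f1]) (auto simp: fin sym if_distrib[of "\<lambda>x. _ * x"] cong: if_cong)
  then have 1: "norm (of_real L * XA + XB) \<le> 2 * C * N ^ 2" by simp
  have "norm (of_real 0 * XA + XB - of_real (0 * L) * XC - of_real L * XD) \<le> 2 * C * N ^ 2"
    by (rule bound[OF f1 fW]) (auto simp: fin if_distrib[of "\<lambda>x. x * _"] cong: if_cong)
  then have 2: "norm (XB - of_real L * XD) \<le> 2 * C * N ^ 2" by simp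
  have 3: "norm (of_real L * XA + XB - of_real (L * (2 * L)) * XC - of_real (2 * L) * XD) \<le> 2 * C * N ^ 2"
  proof (rule bound[OF fU fUW])
    fix p q assume pq: "p \<in> P" "q \<in> P"
    have "(\<Sum>b\<in>P. (if fst p = fst b then 1 else 0) * walsh k (snd b) (snd p)
        * (walsh k (fst b) (fst q) * walsh k (snd b) (snd q))) =
      (\<Sum>i<2 ^ k. if i = fst p then walsh k i (fst q) * (\<Sum>j<2 ^ k. walsh k j (snd p) * walsh k j (snd q)) else 0)"
      unfolding sumP by (intro sum.cong refl) (auto simp: sum_distrib_left mult_ac)
    also have "\<dots> = walsh_id k p q"
      using pq by (auto simp: P_def walsh_orthogonal walsh_id_def)
    finally show "(\<Sum>b\<in>P. (if fst p = fst b then 1 else 0) * walsh k (snd b) (snd p)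
        * (walsh k (fst b) (fst q) * walsh k (snd b) (snd q))) = walsh_id k p q" .
  qed
  let ?e1 = "of_real L * XA + XB" and ?e2 = "XB - of_real L * XD"
    and ?e3 = "of_real L * XA + XB - of_real (L * (2 * L)) * XC - of_real (2 * L) * XD"
  \<comment> \<open>The combination \<open>?e1 - 2 * ?e2 + ?e3\<close> cancels \<open>XB\<close> and
    \<open>XD\<close>; its weights 1, 2, 1 turn the bound \<open>2 * C * N ^ 2\<close> into
    \<open>8 * C * N ^ 2\<close>.\<close>
  have "of_real (2 * L) * XA = (?e1 - 2 * ?e2) + (?e3 + of_real (2 * L\<^sup>2) * XC)"
    by (simp add: algebra_simps power2_eq_square)
  also have "norm \<dots> \<le> (norm ?e1 + norm (2 * ?e2)) + (norm ?e3 + norm (of_real (2 * L\<^sup>2) * XC))"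
    by (intro order_trans[OF norm_triangle_ineq] add_mono norm_triangle_ineq4 norm_triangle_ineq)
  also have "\<dots> \<le> 8 * C * N ^ 2 + 2 * L\<^sup>2 * norm XC"
  proof -
    have "norm (2 * ?e2) = 2 * norm ?e2" "norm (of_real (2 * L\<^sup>2) * XC) = 2 * L\<^sup>2 * norm XC"
      by (simp_all only: norm_mult norm_numeral norm_of_real) simp
    then show ?thesis using 1 2 3 by linarith
  qed
  finally have main: "L * norm XA \<le> 4 * C * N ^ 2 + L\<^sup>2 * norm XC" using L0 by (simp add: norm_mult)
  have w1: "\<bar>walsh_id k p q\<bar> \<le> 1" for p q by (simp add: walsh_id_def abs_walsh)
  have trb: "norm (tr f) \<le> e * N ^ 4" if "\<And>p q. p \<in> P \<Longrightarrow> q \<in> P \<Longrightarrow> norm (f p (pos q)) \<le> e" for f e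
  proof -
    have "norm (of_real (walsh_id k p q) * f p (pos q)) \<le> e" if "p \<in> P" "q \<in> P" for p q
      using mult_mono[OF w1[of p q] \<open>\<And>p q. p \<in> P \<Longrightarrow> q \<in> P \<Longrightarrow> norm (f p (pos q)) \<le> e\<close>[OF that]]
      by (simp add: norm_mult)
    then have "norm (tr f) \<le> (\<Sum>p\<in>P. \<Sum>q\<in>P. e)"
      unfolding tr_def by (intro order_trans[OF norm_sum] sum_mono) auto
    then show ?thesis by (simp add: card power2_eq_square power4_eq_xxxx mult_ac)
  qed
  have XC: "norm XC \<le> \<epsilon> * N ^ 4" unfolding XC_def by (rule trb) (rule d)
  \<comment> \<open>The trace evaluates its argument at \<open>pos q\<close>, so the inverse of
    \<open>pos\<close> serves to read \<open>walsh_id k p q\<close> as a function of the coordinate.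
    The subtracted trace is \<open>c\<close> times the sum of all squared entries of
    \<open>walsh_id k\<close>, which is \<open>card P = N ^ 2\<close>.\<close>
  have "XA - of_real (c * N ^ 2) = tr (\<lambda>p n. fst (B (unit_seq (pos p), \<lambda>_. 0)) n
      - of_real (c * walsh_id k p (the_inv_into P pos n)))"
  proof -
    have "of_real (c * N ^ 2) = (of_real (\<Sum>p\<in>P. \<Sum>q\<in>P. walsh_id k p q * (c * walsh_id k p q)) :: 'k)"
    proof -
      have "(\<Sum>p\<in>P. \<Sum>q\<in>P. walsh_id k p q * (c * walsh_id k p q)) = (\<Sum>p\<in>P. c * (\<Sum>q\<in>P. (walsh_id k p q)\<^sup>2))"
        by (simp add: sum_distrib_left power2_eq_square mult_ac)
      then show ?thesis by (simp add: sumW card mult.commute)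
    qed
    then show ?thesis unfolding XA_def tr_def
      by (simp add: sum_subtractf right_diff_distrib the_inv_into_f_f[OF inj])
  qed
  also have "norm \<dots> \<le> \<epsilon> * N ^ 4"
    by (rule trb) (use a in \<open>simp add: the_inv_into_f_f[OF inj]\<close>)
  finally have "norm (XA - of_real (c * N ^ 2)) \<le> \<epsilon> * N ^ 4" .
  then have "c * N ^ 2 - \<epsilon> * N ^ 4 \<le> norm XA"
    using norm_triangle_ineq2[of "of_real (c * N ^ 2) :: 'k" XA] norm_of_real[of "c * N ^ 2", where 'a='k]
    by (simp only: norm_minus_commute)
  then have "L * (c * N ^ 2 - \<epsilon> * N ^ 4) \<le> L * norm XA" using L0 by (rule mult_left_mono)
  also note main
  also have "4 * C * N ^ 2 + L\<^sup>2 * norm XC \<le> 4 * C * N ^ 2 + L\<^sup>2 * (\<epsilon> * N ^ 4)"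
    using XC by (intro add_left_mono mult_left_mono) auto
  finally show ?thesis .
qed

section \<open>The quotient component of an operator on the first summand\<close>

text \<open>Combining disjointly supported unit vectors with Walsh coefficients adds
  \<open>L = ln (sqrt (2 ^ k))\<close> to the logarithms in \<open>Omega\<close>, while the vectors
  \<open>(unit_seq (n a), 0)\<close> combine without such a cost. Averaging over the Walsh rows
  leaves the individual pairings minus \<open>L * D a\<close>. The mixed and the individual pairings
  are each at most \<open>2 * C\<close>, whence the bound \<open>4 * C\<close>.\<close>

lemma disjoint_blocks_bound:
  fixes T :: "'k::real_or_complex pair_op" and k :: nat and F :: "nat \<Rightarrow> nat set"
  assumes T: "T \<in> LZ2" and C: "\<And>u. u \<in> Z2 \<Longrightarrow> qnorm (T u) \<le> C * qnorm u"
    and n: "inj_on n {..<2 ^ k}"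
    and F: "\<And>a. finite (F a)" "disjoint_family_on F {..<2 ^ k}"
    and \<delta>: "\<delta> > 0" "\<And>a. a < 2 ^ k \<Longrightarrow> \<delta> \<le> L2_set (\<lambda>q. norm (snd (T (unit_seq (n a), \<lambda>_. 0)) q)) (F a)"
  shows "\<delta> * (real k / 2 * ln 2) \<le> 4 * C"
proof -
  define m :: nat where "m = 2 ^ k"
  define L where "L = real k / 2 * ln 2"
  let ?A = "{..<m}"
  let ?e = "\<lambda>a. (unit_seq (n a), \<lambda>_. 0) :: 'k seq_pair"
  define X where "X a = fst (T (?e a))" for a
  define Y where "Y a = snd (T (?e a))" for a
  define D where "D a = L2_set (\<lambda>q. norm (Y a q)) (F a)" for a
  have D: "D a > 0" "\<delta> \<le> D a" if "a < m" for a
    using \<delta> that by (auto simp: D_def Y_def m_def intro: order_less_le_trans)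
  \<comment> \<open>The conjugate of \<open>Y a\<close>, restricted to \<open>F a\<close> and
    normalised. Written as a quotient it needs no conjugation, and division by zero gives the right
    value 0.\<close>
  define z where "z a q = (if q \<in> F a then of_real ((norm (Y a q))\<^sup>2 / D a) / Y a q else 0)" for a q
  have nz: "norm (z a q) = norm (Y a q) / D a" if "a < m" "q \<in> F a" for a q
    using D(1)[OF that(1)] that(2) by (cases "Y a q = 0") (auto simp: z_def norm_divide norm_mult power2_eq_square)
  have DD: "(\<Sum>q\<in>F a. (norm (Y a q))\<^sup>2) = (D a)\<^sup>2" for a by (simp add: D_def L2_set_def sum_nonneg)
  have z2: "norm2 (z a) = 1" if "a < m" for a
  proof -
    have "norm2 (z a) = L2_set (\<lambda>q. norm (z a q)) (F a)"
      by (rule ell2_finite[OF F(1)]) (simp add: z_def)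
    also have "\<dots> = sqrt (\<Sum>q\<in>F a. (norm (Y a q) / D a)\<^sup>2)"
      unfolding L2_set_def by (simp add: nz[OF that] cong: sum.cong)
    also have "\<dots> = 1" using D(1)[OF that] by (simp add: power_divide DD flip: sum_divide_distrib)
    finally show ?thesis .
  qed
  have zY: "(\<Sum>q\<in>F a. z a q * Y a q) = of_real (D a)" if "a < m" for a
  proof -
    have "(\<Sum>q\<in>F a. z a q * Y a q) = (\<Sum>q\<in>F a. of_real ((norm (Y a q))\<^sup>2 / D a))"
      by (intro sum.cong refl) (auto simp: z_def)
    also have "\<dots> = of_real ((\<Sum>q\<in>F a. (norm (Y a q))\<^sup>2) / D a)"
      by (simp only: of_real_sum sum_divide_distrib)
    also have "(\<Sum>q\<in>F a. (norm (Y a q))\<^sup>2) / D a = D a"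
      using D(1)[OF that] by (simp add: DD) (simp add: power2_eq_square)
    finally show ?thesis .
  qed
  define G where "G = (\<Union>a\<in>?A. F a)"
  have finG: "finite G" using F(1) by (simp add: G_def)
  have sumG: "(\<Sum>q\<in>G. f q) = (\<Sum>a<m. \<Sum>q\<in>F a. f q)" for f :: "nat \<Rightarrow> 'x::comm_monoid_add"
    unfolding G_def using F unfolding disjoint_family_on_def
    by (intro sum.UNION_disjoint) (auto simp: m_def)
  define Z where "Z b q = (\<Sum>a<m. of_real (walsh k b a) * z a q)" for b q
  have Zq: "Z b q = of_real (walsh k b a) * z a q" if "a < m" "q \<in> F a" for a b q
  proof -
    have "z a' q = 0" if "a' < m" "a' \<noteq> a" for a'
      using F(2) \<open>a < m\<close> \<open>q \<in> F a\<close> that by (auto simp: z_def m_def disjoint_family_on_def)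
    then have "Z b q = (\<Sum>a'<m. if a' = a then of_real (walsh k b a) * z a q else 0)"
      unfolding Z_def by (intro sum.cong) auto
    then show ?thesis using that by simp
  qed
  have Z0: "Z b q = 0" if "q \<notin> G" for b q
    using that by (auto simp: Z_def z_def G_def intro!: sum.neutral)
  have orth: "(\<Sum>l<m. walsh k i l * walsh k j l) = (if i = j then 1 else 0)" if "i < m" "j < m" for i j
    using walsh_orthogonal[of i k j] that by (simp add: walsh_commute m_def)
  have Z2: "norm2 (Z b) = 1" if b: "b < m" for b
  proof -
    have "norm2 (Z b) = L2_set (\<lambda>q. norm (Z b q)) G" by (rule ell2_finite[OF finG Z0])
    also have "\<dots> = sqrt (\<Sum>a<m. \<Sum>q\<in>F a. (walsh k b a)\<^sup>2 * (norm (z a q))\<^sup>2)"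
      unfolding L2_set_def sumG by (intro arg_cong[of _ _ sqrt] sum.cong refl)
        (simp add: Zq norm_mult power_mult_distrib)
    also have "\<dots> = sqrt (\<Sum>a<m. (walsh k b a)\<^sup>2)"
    proof -
      have "(\<Sum>q\<in>F a. (norm (z a q))\<^sup>2) = 1" if "a < m" for a
        using D(1)[OF that] by (simp add: nz[OF that] power_divide DD flip: sum_divide_distrib cong: sum.cong)
      then show ?thesis by (simp flip: sum_distrib_left)
    qed
    also have "\<dots> = 1" using orth[OF b b] by (simp add: power2_eq_square)
    finally show ?thesis .
  qed
  \<comment> \<open>On \<open>F a\<close> only the summand of \<open>Z b\<close> with index
    \<open>a\<close> survives, and the modulus \<open>exp (- L)\<close> of its coefficient adds
    \<open>L\<close> to the logarithm.\<close>
  have OZ: "Omega (Z b) q = of_real (walsh k b a) * (of_real L * z a q + Omega (z a) q)"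
    if "b < m" "a < m" "q \<in> F a" for a b q
  proof (cases "z a q = 0")
    case True
    then show ?thesis using Zq[OF that(2,3)] by (simp add: Omega_apply)
  next
    case False
    have "ln (1 / norm (Z b q)) = L + ln (1 / norm (z a q))"
      using False by (simp add: Zq[OF that(2,3)] norm_mult walsh_exp ln_div ln_mult L_def)
    then show ?thesis
      by (simp add: Omega_apply Z2[OF that(1)] z2[OF that(2)]) (simp add: Zq[OF that(2,3)] algebra_simps)
  qed
  define g where "g a q a' = z a q * X a' q - (of_real L * z a q + Omega (z a) q) * Y a' q" for a q a'
  have single: "norm (\<Sum>q\<in>F a. z a q * X a q - Omega (z a) q * Y a q) \<le> 2 * C" if a: "a < m" for a
  proof -
    have "norm (\<Sum>q\<in>F a. z a q * X a q - Omega (z a) q * Y a q) \<le> 2 * qnorm (X a, Y a) * norm2 (z a)"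
      by (rule pairing_bound) (use LZ2D(1)[OF T unit_seq_Z2] F(1) in \<open>auto simp: X_def Y_def z_def\<close>)
    also have "qnorm (X a, Y a) \<le> C"
      using C[OF unit_seq_Z2, of "n a"] by (simp add: X_def Y_def qnorm_fst norm2_unit_seq)
    finally show ?thesis by (simp add: z2[OF a])
  qed
  have mixed: "norm (\<Sum>a<m. \<Sum>q\<in>F a. \<Sum>a'<m. of_real (walsh k b a * walsh k b a') * g a q a') \<le> 2 * C"
    if b: "b < m" for b
  proof -
    let ?u = "lincomb ?A (\<lambda>a. of_real (walsh k b a)) ?e"
    have u: "?u = (embed_seq ?A n (\<lambda>a. of_real (walsh k b a)), \<lambda>_. 0)"
      by (simp add: lincomb_def embed_seq_def)
    have inj: "inj_on n ?A" using n by (simp add: m_def)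
    have uZ: "?u \<in> Z2" unfolding u Z2_fst by (rule embed_ell2) (use inj in auto)
    have "qnorm ?u = 1" unfolding u qnorm_fst
      using embed_ell2(2)[OF _ inj, of "\<lambda>a. of_real (walsh k b a) :: 'k"] orth[OF b b]
      by (simp add: L2_set_def power2_eq_square)
    then have q: "qnorm (T ?u) \<le> C" using C[OF uZ] by simp
    have Tu: "T ?u = lincomb ?A (\<lambda>a. of_real (walsh k b a)) (\<lambda>a. T (?e a))"
      by (rule LZ2_lincomb[OF T]) (auto intro: unit_seq_Z2)
    have "norm (\<Sum>q\<in>G. Z b q * fst (T ?u) q - Omega (Z b) q * snd (T ?u) q)
        \<le> 2 * qnorm (fst (T ?u), snd (T ?u)) * norm2 (Z b)"
      by (rule pairing_bound) (use LZ2D(1)[OF T uZ] finG Z0 in auto)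
    also have "\<dots> \<le> 2 * C" using q Z2[OF b] by simp
    also have "(\<Sum>q\<in>G. Z b q * fst (T ?u) q - Omega (Z b) q * snd (T ?u) q) =
        (\<Sum>a<m. \<Sum>q\<in>F a. \<Sum>a'<m. of_real (walsh k b a * walsh k b a') * g a q a')"
      unfolding sumG
    proof (intro sum.cong refl)
      fix a q assume "a \<in> ?A" "q \<in> F a"
      then have "Z b q * fst (T ?u) q - Omega (Z b) q * snd (T ?u) q =
          of_real (walsh k b a) * z a q * (\<Sum>a'<m. of_real (walsh k b a') * X a' q)
          - of_real (walsh k b a) * (of_real L * z a q + Omega (z a) q) * (\<Sum>a'<m. of_real (walsh k b a') * Y a' q)"
        using b unfolding Tu by (simp add: Zq OZ lincomb_def X_def Y_def)
      also have "\<dots> = (\<Sum>a'<m. of_real (walsh k b a * walsh k b a') * g a q a')"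
        unfolding sum_distrib_left sum_subtractf[symmetric]
        by (intro sum.cong refl) (simp add: g_def algebra_simps)
      finally show "Z b q * fst (T ?u) q - Omega (Z b) q * snd (T ?u) q =
        (\<Sum>a'<m. of_real (walsh k b a * walsh k b a') * g a q a')" .
    qed
    finally show ?thesis .
  qed
  have "norm (\<Sum>b<m. \<Sum>a<m. \<Sum>q\<in>F a. \<Sum>a'<m. of_real (walsh k b a * walsh k b a') * g a q a') \<le> (\<Sum>b<m. 2 * C)"
    by (rule order_trans[OF norm_sum], rule sum_mono, rule mixed) simp
  also have "(\<Sum>b<m. \<Sum>a<m. \<Sum>q\<in>F a. \<Sum>a'<m. of_real (walsh k b a * walsh k b a') * g a q a') =
      (\<Sum>a<m. \<Sum>b<m. \<Sum>q\<in>F a. \<Sum>a'<m. of_real (walsh k b a * walsh k b a') * g a q a')"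
    by (rule sum.swap)
  also have "\<dots> = (\<Sum>a<m. \<Sum>q\<in>F a. \<Sum>b<m. \<Sum>a'<m. of_real (walsh k b a * walsh k b a') * g a q a')"
    by (intro sum.cong refl sum.swap)
  also have "\<dots> = (\<Sum>a<m. \<Sum>q\<in>F a. \<Sum>a'<m. \<Sum>b<m. of_real (walsh k b a * walsh k b a') * g a q a')"
    by (intro sum.cong refl sum.swap)
  also have "\<dots> = (\<Sum>a<m. \<Sum>q\<in>F a. \<Sum>a'<m. if a' = a then g a q a else 0)"
  proof (intro sum.cong refl)
    fix a q a' assume "a \<in> ?A" "a' \<in> ?A"
    then have "(\<Sum>b<m. walsh k b a * walsh k b a') = (if a' = a then 1 else 0)"
      using walsh_orthogonal[of a k a'] by (auto simp: m_def)
    then have "(\<Sum>b<m. of_real (walsh k b a * walsh k b a') * g a q a') = of_real (if a' = a then 1 else 0) * g a q a'"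
      by (simp only: of_real_sum[symmetric] sum_distrib_right[symmetric])
    then show "(\<Sum>b<m. of_real (walsh k b a * walsh k b a') * g a q a') = (if a' = a then g a q a else 0)" by auto
  qed
  also have "\<dots> = (\<Sum>a<m. \<Sum>q\<in>F a. g a q a)" by (intro sum.cong refl) simp
  also have "\<dots> = (\<Sum>a<m. (\<Sum>q\<in>F a. z a q * X a q - Omega (z a) q * Y a q) - of_real (L * D a))"
  proof (intro sum.cong refl)
    fix a assume "a \<in> ?A"
    have "(\<Sum>q\<in>F a. g a q a) = (\<Sum>q\<in>F a. z a q * X a q - Omega (z a) q * Y a q) - of_real L * (\<Sum>q\<in>F a. z a q * Y a q)"
      by (simp add: g_def sum_subtractf sum.distrib sum_distrib_left algebra_simps)
    then show "(\<Sum>q\<in>F a. g a q a) = (\<Sum>q\<in>F a. z a q * X a q - Omega (z a) q * Y a q) - of_real (L * D a)"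
      using zY \<open>a \<in> ?A\<close> by simp
  qed
  also have "\<dots> = (\<Sum>a<m. \<Sum>q\<in>F a. z a q * X a q - Omega (z a) q * Y a q) - of_real (\<Sum>a<m. L * D a)"
    by (simp add: sum_subtractf)
  finally have 1: "norm ((\<Sum>a<m. \<Sum>q\<in>F a. z a q * X a q - Omega (z a) q * Y a q) - of_real (\<Sum>a<m. L * D a)) \<le> m * (2 * C)"
    by simp
  have "norm (\<Sum>a<m. \<Sum>q\<in>F a. z a q * X a q - Omega (z a) q * Y a q) \<le> (\<Sum>a<m. 2 * C)"
    by (rule order_trans[OF norm_sum], rule sum_mono, rule single) simp
  then have 2: "norm (\<Sum>a<m. \<Sum>q\<in>F a. z a q * X a q - Omega (z a) q * Y a q) \<le> m * (2 * C)" by simp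
  have "\<bar>\<Sum>a<m. L * D a\<bar> \<le> m * (2 * C) + m * (2 * C)"
    using 1 2 norm_triangle_ineq2[of "of_real (\<Sum>a<m. L * D a) :: 'k"
        "\<Sum>a<m. \<Sum>q\<in>F a. z a q * X a q - Omega (z a) q * Y a q"]
    unfolding norm_of_real norm_minus_commute[of "of_real (\<Sum>a<m. L * D a)"] by linarith
  moreover have "m * (L * \<delta>) \<le> (\<Sum>a<m. L * D a)"
  proof -
    have "(\<Sum>a<m. L * \<delta>) \<le> (\<Sum>a<m. L * D a)" by (intro sum_mono mult_left_mono) (auto simp: D L_def)
    then show ?thesis by simp
  qed
  ultimately have "m * (L * \<delta>) \<le> m * (4 * C)" by linarith
  then show ?thesis by (simp add: m_def L_def mult.commute)
qed

text \<open>A coordinate of the second component of \<open>T (x, 0)\<close> is a bounded functional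
  of \<open>x\<close>, so its coefficients are square summable. Testing on their conjugates
  \<open>t\<close> gives \<open>S ^ 2 \<le> C * S\<close>.\<close>

lemma snd_coordinate_tendsto_0:
  fixes T :: "'k::real_or_complex pair_op"
  assumes T: "T \<in> LZ2"
  shows "(\<lambda>n. snd (T (unit_seq n, \<lambda>_. 0)) q) \<longlonglongrightarrow> 0"
proof -
  obtain C where C: "C > 0" "\<And>u. u \<in> Z2 \<Longrightarrow> qnorm (T u) \<le> C * qnorm u" using LZ2_bound[OF T] by metis
  define s where "s n = snd (T (unit_seq n, \<lambda>_. 0)) q" for n
  have bound: "(\<Sum>n<m. (norm (s n))\<^sup>2) \<le> C\<^sup>2" for m
  proof -
    define t where "t n = of_real ((norm (s n))\<^sup>2) / s n" for n
    define S where "S = L2_set (\<lambda>n. norm (s n)) {..<m}"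
    have S: "(\<Sum>n<m. (norm (s n))\<^sup>2) = S\<^sup>2" "S \<ge> 0" by (auto simp: S_def L2_set_def sum_nonneg)
    have nt: "norm (t n) = norm (s n)" for n by (simp add: t_def norm_divide norm_mult power2_eq_square)
    let ?u = "lincomb {..<m} t (\<lambda>n. (unit_seq n, \<lambda>_. 0))"
    have u: "?u = (embed_seq {..<m} (\<lambda>n. n) t, \<lambda>_. 0)" by (simp add: lincomb_def embed_seq_def)
    have uZ: "?u \<in> Z2" unfolding u Z2_fst by (rule embed_ell2) auto
    have qu: "qnorm ?u = S" unfolding u qnorm_fst S_def
      using embed_ell2(2)[of "{..<m}" "\<lambda>n. n" t] by (simp add: nt)
    obtain x y where xy: "T ?u = (x, y)" by (cases "T ?u")
    have "(x, y) \<in> Z2" using LZ2D(1)[OF T uZ] xy by simp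
    then have y: "y \<in> ell2" "norm2 (\<lambda>n. x n - Omega y n) \<ge> 0" by (auto simp: Z2_iff norm2_nonneg)
    have "y q = snd (T ?u) q" using xy by simp
    also have "\<dots> = (\<Sum>n<m. t n * s n)"
      by (subst LZ2_lincomb[OF T]) (auto intro: unit_seq_Z2 simp: lincomb_def s_def)
    also have "\<dots> = (\<Sum>n<m. of_real ((norm (s n))\<^sup>2))" by (intro sum.cong) (auto simp: t_def)
    also have "\<dots> = of_real (S\<^sup>2)" by (simp only: S(1)[symmetric] of_real_sum)
    finally have "S\<^sup>2 = norm (y q)" by (simp add: norm_power)
    also have "\<dots> \<le> qnorm (T ?u)" using norm_le_norm2[OF y(1), of q] y(2) by (simp add: xy qnorm_Pair)
    also have "\<dots> \<le> C * S" using C(2)[OF uZ] by (simp add: qu)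
    finally have "S \<le> C" using S(2) C(1) by (cases "S = 0") (auto simp: power2_eq_square)
    then show ?thesis unfolding S(1) using S(2) by (intro power_mono)
  qed
  have "summable (\<lambda>n. (norm (s n))\<^sup>2)"
    by (rule summableI_nonneg_bounded[where x="C\<^sup>2"]) (use bound in auto)
  then have "(\<lambda>n. (norm (s n))\<^sup>2) \<longlonglongrightarrow> 0" by (rule summable_LIMSEQ_zero)
  then have "(\<lambda>n. sqrt ((norm (s n))\<^sup>2)) \<longlonglongrightarrow> sqrt 0" by (rule tendsto_real_sqrt)
  then show ?thesis by (simp add: s_def tendsto_norm_zero_iff)
qed

text \<open>
  The quotient map \<open>(x, y) \<mapsto> y\<close> is strictly singular, so its composition with an operator from
  \<open>\<ell>\<^sub>2\<close> is compact. Otherwise a gliding hump would produce the disjoint blocks excluded above.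
\<close>

lemma snd_tendsto_0:
  fixes T :: "'k::real_or_complex pair_op"
  assumes T: "T \<in> LZ2"
  shows "(\<lambda>n. norm2 (snd (T (unit_seq n, \<lambda>_. 0)))) \<longlonglongrightarrow> 0"
proof (rule ccontr)
  obtain C where C: "C > 0" "\<And>u. u \<in> Z2 \<Longrightarrow> qnorm (T u) \<le> C * qnorm u" using LZ2_bound[OF T] by metis
  define Y where "Y n = snd (T (unit_seq n, \<lambda>_. 0))" for n
  have Y: "Y n \<in> ell2" for n
    using LZ2D(1)[OF T unit_seq_Z2[of n]] by (cases "T (unit_seq n, \<lambda>_. 0)") (auto simp: Y_def Z2_iff)
  assume "\<not> ?thesis"
  then obtain d where d: "d > 0" "\<And>m. \<exists>n\<ge>m. norm2 (Y n) \<ge> d"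
    unfolding Y_def[symmetric] lim_sequentially
    by (force simp: dist_real_def norm2_nonneg[OF Y] not_less)
  \<comment> \<open>For large \<open>n\<close> the coordinates below \<open>p\<close> carry less
    than \<open>d / 4\<close>, while a long initial segment carries more than \<open>d / 2\<close>;
    the window between them retains at least \<open>d / 4\<close>.\<close>
  have step: "\<exists>n p'. n > n0 \<and> p' > p \<and> d / 4 \<le> L2_set (\<lambda>q. norm (Y n q)) {p..<p'}" for n0 p
  proof -
    have "(\<lambda>n. L2_set (\<lambda>q. norm (Y n q)) {..<p}) \<longlonglongrightarrow> sqrt (\<Sum>q<p. 0\<^sup>2)"
      unfolding L2_set_def using snd_coordinate_tendsto_0[OF T]
      by (intro tendsto_intros) (auto simp: Y_def intro: tendsto_norm_zero)
    then have "eventually (\<lambda>n. L2_set (\<lambda>q. norm (Y n q)) {..<p} < d / 4) sequentially"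
      using d(1) by (intro order_tendstoD) auto
    then obtain n1 where n1: "\<And>n. n \<ge> n1 \<Longrightarrow> L2_set (\<lambda>q. norm (Y n q)) {..<p} < d / 4"
      by (auto simp: eventually_sequentially)
    obtain n where n: "n \<ge> max n1 (Suc n0)" "norm2 (Y n) \<ge> d" using d(2) by blast
    have "\<exists>m. L2_set (\<lambda>q. norm (Y n q)) {..<m} > d / 2"
    proof (rule ccontr)
      assume "\<not> ?thesis"
      then have "norm2 (Y n) \<le> d / 2" by (intro ell2_bounded) (auto simp: not_less)
      then show False using n(2) d(1) by simp
    qed
    then obtain m where m: "L2_set (\<lambda>q. norm (Y n q)) {..<m} > d / 2" by blast
    define p' where "p' = max m (Suc p)"
    have un: "{..<p'} = {..<p} \<union> {p..<p'}" by (auto simp: p'_def)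
    have "L2_set (\<lambda>q. norm (Y n q)) {..<m} \<le> L2_set (\<lambda>q. norm (Y n q)) {..<p'}"
      unfolding L2_set_def by (intro real_sqrt_le_mono sum_mono2) (auto simp: p'_def)
    also have "\<dots> \<le> L2_set (\<lambda>q. norm (Y n q)) {..<p} + L2_set (\<lambda>q. norm (Y n q)) {p..<p'}"
      unfolding L2_set_def un by (subst sum.union_disjoint) (auto intro!: sqrt_add_le_add_sqrt sum_nonneg)
    finally have "d / 4 \<le> L2_set (\<lambda>q. norm (Y n q)) {p..<p'}" using m n1[of n] n(1) by simp
    then show ?thesis using n(1) by (intro exI[of _ n] exI[of _ p']) (auto simp: p'_def)
  qed
  \<comment> \<open>The pair \<open>f a\<close> holds the last index chosen and the right end of its
    window. The initial pair is arbitrary, so the estimate concerns the index in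
    \<open>f (Suc a)\<close>.\<close>
  have "\<exists>f :: nat \<Rightarrow> nat \<times> nat. \<forall>a. True \<and> (fst (f (Suc a)) > fst (f a) \<and> snd (f (Suc a)) > snd (f a) \<and>
      d / 4 \<le> L2_set (\<lambda>q. norm (Y (fst (f (Suc a))) q)) {snd (f a)..<snd (f (Suc a))})"
    by (intro dependent_nat_choice) (use step in auto)
  then obtain f :: "nat \<Rightarrow> nat \<times> nat" where f: "\<And>a. fst (f (Suc a)) > fst (f a)" "\<And>a. snd (f (Suc a)) > snd (f a)"
    "\<And>a. d / 4 \<le> L2_set (\<lambda>q. norm (Y (fst (f (Suc a))) q)) {snd (f a)..<snd (f (Suc a))}" by blast
  have sm: "strict_mono (\<lambda>a. fst (f a))" "strict_mono (\<lambda>a. snd (f a))"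
    using f by (auto simp: strict_mono_Suc_iff)
  have bound: "d / 4 * (real k / 2 * ln 2) \<le> 4 * C" for k
  proof (rule disjoint_blocks_bound[OF T C(2), where n="\<lambda>a. fst (f (Suc a))"
        and F="\<lambda>a. {snd (f a)..<snd (f (Suc a))}"])
    show "inj_on (\<lambda>a. fst (f (Suc a))) {..<2 ^ k}"
      using strict_mono_eq[OF sm(1)] by (auto simp: inj_on_def)
    show "disjoint_family_on (\<lambda>a. {snd (f a)..<snd (f (Suc a))}) {..<2 ^ k}"
      unfolding disjoint_family_on_def
    proof (intro ballI impI)
      fix a b :: nat assume "a \<noteq> b"
      have "snd (f (Suc a)) \<le> snd (f b)" if "a < b" for a b
        using strict_mono_less_eq[OF sm(2), of "Suc a" b] that by simp
      then show "{snd (f a)..<snd (f (Suc a))} \<inter> {snd (f b)..<snd (f (Suc b))} = {}"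
        using \<open>a \<noteq> b\<close> by (cases a b rule: linorder_cases) (auto dest: order_less_le_trans leD)
    qed
  qed (use f d(1) in \<open>auto simp: Y_def\<close>)
  obtain k :: nat where "4 * C / (d / 8 * ln 2) < k" using reals_Archimedean2 by blast
  then have "4 * C < d / 4 * (real k / 2 * ln 2)" using d(1) by (simp add: field_simps)
  then show False using bound[of k] by simp
qed

section \<open>Block operators\<close>

text \<open>
  Position \<open>i\<close> of the \<open>j\<close>-th block of type \<open>k\<close>. Blocks of type \<open>k\<close> have size \<open>2 ^ expo k\<close>;
  the positions beyond it are not used.
\<close>

definition coord :: "nat \<Rightarrow> nat \<Rightarrow> nat \<Rightarrow> nat" where
  "coord k j i = prod_encode (k, prod_encode (j, i))"

definition blk_type :: "nat \<Rightarrow> nat" where "blk_type p = fst (prod_decode p)"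
definition blk_no :: "nat \<Rightarrow> nat" where "blk_no p = fst (prod_decode (snd (prod_decode p)))"
definition blk_pos :: "nat \<Rightarrow> nat" where "blk_pos p = snd (prod_decode (snd (prod_decode p)))"

text \<open>The logarithm of the block size grows quadratically, hence is still unbounded after
  multiplication by the coefficient \<open>1 / (k + 1)\<close>.\<close>

definition expo :: "nat \<Rightarrow> nat" where "expo k = (k + 1)\<^sup>2"

lemma coord_simps [simp]: "blk_type (coord k j i) = k" "blk_no (coord k j i) = j" "blk_pos (coord k j i) = i"
  by (simp_all add: coord_def blk_type_def blk_no_def blk_pos_def)

lemma coord_surj [simp]: "coord (blk_type p) (blk_no p) (blk_pos p) = p"
  by (simp add: coord_def blk_type_def blk_no_def blk_pos_def)

lemma coord_eq_iff [simp]: "coord k j i = coord k' j' i' \<longleftrightarrow> k = k' \<and> j = j' \<and> i = i'"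
  by (auto simp: coord_def)

definition block_op :: "(nat \<Rightarrow> real) \<Rightarrow> (nat \<Rightarrow> 'k) \<Rightarrow> nat \<Rightarrow> 'k::real_or_complex" where
  "block_op c x p = (if blk_pos p < 2 ^ expo (blk_type p) then of_real (c (blk_type p)) *
     (\<Sum>l<2 ^ expo (blk_type p). of_real (walsh (expo (blk_type p)) (blk_pos p) l) * x (coord (blk_type p) (blk_no p) l)) else 0)"

lemma block_op_diff: "block_op (\<lambda>k. c k - d k) x p = block_op c x p - block_op d x p"
  by (simp add: block_op_def left_diff_distrib)

lemma block_op_add: "block_op c (\<lambda>n. x n + y n) p = block_op c x p + block_op c y p"
  by (simp add: block_op_def distrib_left sum.distrib)

text \<open>On each block the operator is \<open>c k\<close> times a Walsh isometry.\<close>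

lemma block_op_bound:
  fixes x :: "nat \<Rightarrow> 'k::real_or_complex"
  assumes c: "\<And>k. \<bar>c k\<bar> \<le> e" and x: "x \<in> ell2"
  shows "block_op c x \<in> ell2" and "norm2 (block_op c x) \<le> e * norm2 x"
proof -
  have e: "e \<ge> 0" using c[of 0] by simp
  have "L2_set (\<lambda>p. norm (block_op c x p)) {..<n} \<le> e * norm2 x" for n
  proof -
    \<comment> \<open>An initial segment may cut through blocks. It is therefore enlarged to a
      finite union of complete blocks, to which \<open>walsh_parseval\<close> applies.\<close>
    define I where "I = (SIGMA b:(\<lambda>p. (blk_type p, blk_no p)) ` {..<n}. {..<2 ^ expo (fst b) :: nat})"
    define \<phi> where "\<phi> b = coord (fst (fst b)) (snd (fst b)) (snd b)" for b
    have I: "finite I" by (simp add: I_def)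
    have inj: "inj_on \<phi> I" by (auto simp: inj_on_def \<phi>_def)
    have sumI: "(\<Sum>p\<in>\<phi> ` I. f p) = (\<Sum>b\<in>(\<lambda>p. (blk_type p, blk_no p)) ` {..<n}. \<Sum>i<2 ^ expo (fst b). f (coord (fst b) (snd b) i))"
      for f :: "nat \<Rightarrow> real"
      unfolding sum.reindex[OF inj] unfolding I_def
      by (subst sum.Sigma) (auto simp: \<phi>_def intro!: sum.cong)
    have "(\<Sum>p<n. (norm (block_op c x p))\<^sup>2) \<le> (\<Sum>p\<in>{p\<in>{..<n}. blk_pos p < 2 ^ expo (blk_type p)}. (norm (block_op c x p))\<^sup>2)"
      by (rule eq_refl, rule sum.mono_neutral_right) (auto simp: block_op_def)
    also have "\<dots> \<le> (\<Sum>p\<in>\<phi> ` I. (norm (block_op c x p))\<^sup>2)"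
    proof (rule sum_mono2)
      show "{p\<in>{..<n}. blk_pos p < 2 ^ expo (blk_type p)} \<subseteq> \<phi> ` I"
      proof
        fix p assume p: "p \<in> {p\<in>{..<n}. blk_pos p < 2 ^ expo (blk_type p)}"
        have "p = \<phi> ((blk_type p, blk_no p), blk_pos p)" by (simp add: \<phi>_def)
        moreover have "((blk_type p, blk_no p), blk_pos p) \<in> I" using p by (auto simp: I_def)
        ultimately show "p \<in> \<phi> ` I" by blast
      qed
    qed (use I in auto)
    also have "\<dots> \<le> (\<Sum>b\<in>(\<lambda>p. (blk_type p, blk_no p)) ` {..<n}. e\<^sup>2 * (\<Sum>i<2 ^ expo (fst b). (norm (x (coord (fst b) (snd b) i)))\<^sup>2))"
      unfolding sumI
    proof (rule sum_mono)
      fix b :: "nat \<times> nat"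
      let ?m = "expo (fst b)"
      have "(\<Sum>i<2 ^ ?m. (norm (block_op c x (coord (fst b) (snd b) i)))\<^sup>2) =
          (c (fst b))\<^sup>2 * (\<Sum>i<2 ^ ?m. (norm (\<Sum>l<2 ^ ?m. of_real (walsh ?m i l) * x (coord (fst b) (snd b) l)))\<^sup>2)"
        by (simp add: block_op_def norm_mult power_mult_distrib flip: sum_distrib_left)
      also have "\<dots> = (c (fst b))\<^sup>2 * (\<Sum>i<2 ^ ?m. (norm (x (coord (fst b) (snd b) i)))\<^sup>2)"
        by (simp only: walsh_parseval)
      also have "\<dots> \<le> e\<^sup>2 * (\<Sum>i<2 ^ ?m. (norm (x (coord (fst b) (snd b) i)))\<^sup>2)"
        using c[of "fst b"] by (intro mult_right_mono sum_nonneg) (auto simp: abs_le_square_iff[symmetric] e)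
      finally show "(\<Sum>i<2 ^ ?m. (norm (block_op c x (coord (fst b) (snd b) i)))\<^sup>2) \<le>
        e\<^sup>2 * (\<Sum>i<2 ^ ?m. (norm (x (coord (fst b) (snd b) i)))\<^sup>2)" .
    qed
    also have "\<dots> = e\<^sup>2 * (\<Sum>p\<in>\<phi> ` I. (norm (x p))\<^sup>2)" unfolding sumI by (simp add: sum_distrib_left)
    finally have "L2_set (\<lambda>p. norm (block_op c x p)) {..<n} \<le> e * L2_set (\<lambda>p. norm (x p)) (\<phi> ` I)"
      unfolding L2_set_def using e
      by (metis real_sqrt_le_mono real_sqrt_mult real_sqrt_abs abs_of_nonneg)
    also have "\<dots> \<le> e * norm2 x" using L2_set_le_norm2[OF x finite_imageI[OF I]] e by (rule mult_left_mono)
    finally show ?thesis .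
  qed
  from ell2_bounded[OF this] show "block_op c x \<in> ell2" "norm2 (block_op c x) \<le> e * norm2 x" by auto
qed

text \<open>One matrix entry \<open>(i, l)\<close>, taken in all blocks of type \<open>k\<close> at
  once, is a weighted composition. The cutoff leaves finitely many of these; no bound uniform in
  \<open>n\<close> is obtained.\<close>

lemma block_op_LZ2:
  assumes c: "\<And>k. \<bar>c k\<bar> \<le> 1" and n: "\<And>k. k \<ge> n \<Longrightarrow> c k = 0"
  shows "diag_op (block_op c) \<in> (LZ2 :: 'k::real_or_complex pair_op set)"
proof -
  define w where "w k i l p = (if blk_type p = k \<and> blk_pos p = i then c k * walsh (expo k) i l else 0)" for k i l p
  define \<sigma> where "\<sigma> k l p = coord k (blk_no p) l" for k l p
  have abs_w: "\<bar>w k i l p\<bar> \<le> 1" for k i l p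
    using mult_mono[OF c[of k], of "1 / sqrt (2 ^ expo k)" 1] by (auto simp: w_def abs_mult abs_walsh)
  have inj_w: "inj_on (\<sigma> k l) {p. w k i l p \<noteq> 0}" for k i l
    unfolding inj_on_def w_def \<sigma>_def by (auto split: if_splits) (metis coord_surj)
  have eq: "block_op c = (\<lambda>(x :: nat \<Rightarrow> 'k) p. \<Sum>k<n. \<Sum>i<2 ^ expo k. \<Sum>l<2 ^ expo k. wcomp (w k i l) (\<sigma> k l) x p)"
  proof (intro ext)
    fix x :: "nat \<Rightarrow> 'k" and p
    let ?s = "\<lambda>k i. of_real (c k) * (\<Sum>l<2 ^ expo k. of_real (walsh (expo k) i l) * x (coord k (blk_no p) l))"
    have "(\<Sum>k<n. \<Sum>i<2 ^ expo k. \<Sum>l<2 ^ expo k. wcomp (w k i l) (\<sigma> k l) x p) =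
        (\<Sum>k<n. \<Sum>i<2 ^ expo k. if i = blk_pos p then if k = blk_type p then ?s k i else 0 else 0)"
      by (intro sum.cong refl) (auto simp: wcomp_def w_def \<sigma>_def sum_distrib_left mult.assoc)
    also have "\<dots> = (\<Sum>k<n. if k = blk_type p then if blk_pos p < 2 ^ expo k then ?s k (blk_pos p) else 0 else 0)"
      by (intro sum.cong refl) (simp add: sum.delta)
    also have "\<dots> = block_op c x p" using n[of "blk_type p"] by (auto simp: block_op_def not_less)
    finally show "block_op c x p = (\<Sum>k<n. \<Sum>i<2 ^ expo k. \<Sum>l<2 ^ expo k. wcomp (w k i l) (\<sigma> k l) x p)" by simp
  qed
  show ?thesis unfolding eq
    by (intro diag_op_sum_LZ2 finite_lessThan wcomp_LZ2 abs_w inj_w)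
qed

text \<open>Split \<open>u = (x, y)\<close> into \<open>(x - Omega y, 0)\<close> and
  \<open>(Omega y, y)\<close>. On the first vector only the \<open>ell2\<close> norm of the block
  operator counts; the possibly large constant \<open>D\<close> is attached to \<open>y\<close>
  alone.\<close>

lemma diag_block_op_estimate:
  fixes c :: "nat \<Rightarrow> real"
  assumes A: "diag_op (block_op c) \<in> (LZ2 :: 'k::real_or_complex pair_op set)" and c: "\<And>k. \<bar>c k\<bar> \<le> e"
  obtains D where "\<And>u :: 'k seq_pair. u \<in> Z2 \<Longrightarrow> qnorm (diag_op (block_op c) u) \<le> e * qnorm u + D * norm2 (snd u)"
proof -
  obtain D where D: "\<And>u :: 'k seq_pair. u \<in> Z2 \<Longrightarrow> qnorm (diag_op (block_op c) u) \<le> D * qnorm u"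
    using LZ2_bound[OF A] by metis
  have "qnorm (diag_op (block_op c) u) \<le> e * qnorm u + D * norm2 (snd u)" if u: "u \<in> Z2" for u :: "'k seq_pair"
  proof -
    obtain x y where xy: "u = (x, y)" by (cases u)
    have y: "y \<in> ell2" and x: "(\<lambda>n. x n - Omega y n) \<in> ell2" using u by (auto simp: xy Z2_iff)
    have z: "(Omega y, y) \<in> Z2" by (rule Z2_Omega[OF y])
    have Az: "(block_op c (Omega y), block_op c y) \<in> Z2" using LZ2D(1)[OF A z] z by (simp add: diag_op_def)
    then have cy: "(\<lambda>n. block_op c (Omega y) n - Omega (block_op c y) n) \<in> ell2" by (simp add: Z2_iff)
    have "qnorm (block_op c (Omega y), block_op c y) \<le> D * norm2 y"
      using D[OF z] z by (simp add: diag_op_def qnorm_Omega)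
    then have 1: "norm2 (\<lambda>n. block_op c (Omega y) n - Omega (block_op c y) n) \<le> D * norm2 y"
      using norm2_nonneg[OF block_op_bound(1)[where c=c, OF c y]] by (simp add: qnorm_Pair)
    have "block_op c x n = block_op c (\<lambda>n. x n - Omega y n) n + block_op c (Omega y) n" for n
      using block_op_add[of c "\<lambda>n. x n - Omega y n" "Omega y" n] by simp
    then have eq: "(\<lambda>n. block_op c x n - Omega (block_op c y) n) = (\<lambda>n. block_op c (\<lambda>n. x n - Omega y n) n
        + (block_op c (Omega y) n - Omega (block_op c y) n))" by (simp add: add_diff_eq)
    have "norm2 (\<lambda>n. block_op c x n - Omega (block_op c y) n) \<le> e * norm2 (\<lambda>n. x n - Omega y n) + D * norm2 y"
      unfolding eq using ell2_add(2)[OF block_op_bound(1)[where c=c, OF c x] cy] block_op_bound(2)[where c=c, OF c x] 1 by simp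
    then show ?thesis using u block_op_bound(2)[where c=c, OF c y]
      by (simp add: diag_op_def xy qnorm_Pair algebra_simps)
  qed
  then show ?thesis by (rule that)
qed

text \<open>The form tests operators only on the vectors \<open>(unit_seq j, 0)\<close>. Composition
  with \<open>select_op k i\<close> moves the test to position \<open>i\<close> of block
  \<open>j\<close> of type \<open>k\<close>.\<close>

definition select_op :: "nat \<Rightarrow> nat \<Rightarrow> 'k::real_or_complex pair_op" where
  "select_op k i = diag_op (wcomp (\<lambda>p. if blk_type p = k \<and> blk_pos p = i then 1 else 0) blk_no)"

lemma select_op_LZ2: "select_op k i \<in> LZ2"
  unfolding select_op_def
proof (rule wcomp_LZ2)
  show "inj_on blk_no {p. (if blk_type p = k \<and> blk_pos p = i then 1 else 0 :: real) \<noteq> 0}"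
    by (auto simp: inj_on_def) (metis coord_surj)
qed auto

lemma select_op_unit: "select_op k i (unit_seq j, \<lambda>_. 0) = (unit_seq (coord k j i), \<lambda>_. 0)"
proof -
  let ?w = "\<lambda>p. if blk_type p = k \<and> blk_pos p = i then 1 else 0"
  have "wcomp ?w blk_no (unit_seq j) = unit_seq (coord k j i)"
  proof
    fix p
    have "p = coord k j i \<longleftrightarrow> blk_type p = k \<and> blk_no p = j \<and> blk_pos p = i" by (metis coord_simps coord_surj)
    then show "wcomp ?w blk_no (unit_seq j) p = unit_seq (coord k j i) p" by (auto simp: wcomp_def unit_seq_def)
  qed
  moreover have "wcomp ?w blk_no (\<lambda>_. 0) = (\<lambda>_. 0)" by (simp add: wcomp_def fun_eq_iff)
  ultimately show ?thesis by (simp add: select_op_def diag_op_def unit_seq_Z2)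
qed

text \<open>The range of \<open>select_op k i\<close> is supported on blocks of type
  \<open>k\<close>, where no other coefficient acts.\<close>

lemma block_op_select_op:
  assumes "c k = d k"
  shows "diag_op (block_op c) \<circ> select_op k i = diag_op (block_op d) \<circ> select_op k i"
proof
  fix u :: "'k::real_or_complex seq_pair"
  let ?w = "wcomp (\<lambda>p. if blk_type p = k \<and> blk_pos p = i then 1 else 0) blk_no"
  have "block_op c (?w x) = block_op d (?w x)" for x :: "nat \<Rightarrow> 'k"
  proof
    fix p
    show "block_op c (?w x) p = block_op d (?w x) p"
      by (cases "blk_type p = k") (use assms in \<open>auto simp: block_op_def wcomp_def\<close>)
  qed
  then have "diag_op (block_op c) (?w x, ?w y) = diag_op (block_op d) (?w x, ?w y)" for x y :: "nat \<Rightarrow> 'k"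
    by (simp add: diag_op_def)
  moreover have "diag_op (block_op c) zero_pair = (diag_op (block_op d) zero_pair :: 'k seq_pair)"
    by (simp add: diag_op_def zero_pair_def block_op_def fun_eq_iff)
  ultimately show "(diag_op (block_op c) \<circ> select_op k i) u = (diag_op (block_op d) \<circ> select_op k i) u"
    by (simp add: select_op_def diag_op_def[of "?w" u])
qed

lemma block_op_unit:
  assumes "i < 2 ^ expo k" "i' < 2 ^ expo k"
  shows "block_op c (unit_seq (coord k j i)) (coord k j' i') =
    (of_real (c k * walsh_id (expo k) (i, j) (i', j')) :: 'k::real_or_complex)"
proof -
  let ?v = "of_real (walsh_id (expo k) (i, j) (i', j')) :: 'k"
  have "of_real (walsh (expo k) i' l) * unit_seq (coord k j i) (coord k j' l) = (if l = i then ?v else 0)" for l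
    by (simp add: unit_seq_def walsh_id_def walsh_commute)
  then show ?thesis using assms by (simp add: block_op_def)
qed

section \<open>The Hilbert space and the representation\<close>

text \<open>Finitely many points can be avoided simultaneously. Hence ordinary limits of sequences
  are also limits along \<open>U\<close>.\<close>

lemma nontrivial_ultrafilter_le_sequentially:
  assumes "nontrivial_ultrafilter U"
  shows "U \<le> sequentially"
  unfolding le_sequentially
proof
  fix N
  have "eventually (\<lambda>n. \<forall>m\<in>{..<N}. n \<noteq> m) U"
    by (rule eventually_ball_finite) (use assms in \<open>auto simp: nontrivial_ultrafilter_def\<close>)
  then show "eventually (\<lambda>n. N \<le> n) U" by (rule eventually_mono) (auto simp: not_less[symmetric])
qed

lemma LZ2_range: "T \<in> LZ2 \<Longrightarrow> T u \<in> Z2"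
  using LZ2D(1,2)[of T u] zero_pair_Z2 by (cases "u \<in> Z2") auto

lemma comp_add_op:
  assumes "A \<in> LZ2" "S \<in> LZ2" "T \<in> LZ2"
  shows "A \<circ> add_op S T = add_op (A \<circ> S) (A \<circ> T)"
  using assms by (auto simp: add_op_def LZ2D(3) LZ2_range)

lemma comp_scale_op:
  assumes "A \<in> LZ2" "T \<in> LZ2"
  shows "A \<circ> scale_op a T = scale_op a (A \<circ> T)"
  using assms by (auto simp: scale_op_def LZ2D(4) LZ2_range)

definition diff_op :: "'k::real_or_complex pair_op \<Rightarrow> 'k pair_op \<Rightarrow> 'k pair_op" where
  "diff_op S T = add_op S (scale_op (-1) T)"

lemma diff_op_LZ2: "S \<in> LZ2 \<Longrightarrow> T \<in> LZ2 \<Longrightarrow> diff_op S T \<in> LZ2"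
  by (simp add: diff_op_def LZ2_add_op LZ2_scale_op)

lemma comp_diff_op:
  assumes "A \<in> LZ2" "S \<in> LZ2" "T \<in> LZ2"
  shows "A \<circ> diff_op S T = diff_op (A \<circ> S) (A \<circ> T)"
  using assms by (simp add: diff_op_def comp_add_op comp_scale_op LZ2_scale_op)

locale kalton_swanson =
  fixes U :: "nat filter"
    and form :: "'k::real_or_complex pair_op \<Rightarrow> 'k pair_op \<Rightarrow> 'k"
    and sc :: "'k \<Rightarrow> 'h::banach \<Rightarrow> 'h"
    and ip :: "'h \<Rightarrow> 'h \<Rightarrow> 'k"
    and tilde :: "'k pair_op \<Rightarrow> 'h"
  assumes U: "nontrivial_ultrafilter U"
    and form: "kalton_swanson_form U form"
    and completion: "completion_of_form form sc ip tilde"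
begin

sublocale hilbert_space_over sc ip
  using completion by (simp add: completion_of_form_def)

lemma U_ne: "U \<noteq> bot"
  using U by (simp add: nontrivial_ultrafilter_def)

lemma tilde_add: "S \<in> LZ2 \<Longrightarrow> T \<in> LZ2 \<Longrightarrow> tilde (add_op S T) = tilde S + tilde T"
  and tilde_scale: "T \<in> LZ2 \<Longrightarrow> tilde (scale_op a T) = sc a (tilde T)"
  and ip_tilde: "S \<in> LZ2 \<Longrightarrow> T \<in> LZ2 \<Longrightarrow> ip (tilde S) (tilde T) = form S T"
  and tilde_dense: "closure (tilde ` LZ2) = UNIV"
  using completion by (auto simp: completion_of_form_def)

lemma tilde_diff:
  assumes "S \<in> LZ2" "T \<in> LZ2"
  shows "tilde (diff_op S T) = tilde S - tilde T"
  using assms sc_of_real[of "-1" "tilde T"] by (simp add: diff_op_def tilde_add tilde_scale LZ2_scale_op)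

lemma norm_sc: "norm (sc a x) = norm a * norm x"
proof -
  have "of_real ((norm (sc a x))\<^sup>2) = a * conjugate (ip (sc a x) x)"
    by (metis ip_norm ip_scale_left ip_conjugate)
  also have "\<dots> = a * conjugate (a * of_real ((norm x)\<^sup>2))" by (simp only: ip_scale_left ip_norm)
  also have "\<dots> = (a * conjugate a) * of_real ((norm x)\<^sup>2)"
    by (simp only: conjugate_dist_mul conjugate_of_real mult.assoc)
  also have "\<dots> = of_real ((norm a * norm x)\<^sup>2)"
    by (simp add: mult_conjugate_self of_real_def power_mult_distrib mult_scaleR_left)
  finally have "(norm (sc a x))\<^sup>2 = (norm a * norm x)\<^sup>2" by (simp only: of_real_eq_iff)
  then show ?thesis by (simp add: power2_eq_iff_nonneg)
qed

lemma sc_bounded_linear: "bounded_linear (sc a)"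
proof (rule bounded_linear_intro[where K="norm a"])
  show "sc a (r *\<^sub>R x) = r *\<^sub>R sc a x" for r x
    by (simp add: sc_of_real[symmetric] mult.commute)
qed (auto simp: scale_right_distrib norm_sc mult.commute)

lemma qnorm_tendsto:
  assumes T: "T \<in> LZ2"
  shows "((\<lambda>n. qnorm (T (unit_seq n, \<lambda>_. 0))) \<longlongrightarrow> norm (tilde T)) U"
proof -
  obtain r where r: "form T T = of_real r" "((\<lambda>n. (qnorm (T (unit_seq n, \<lambda>_. 0)))\<^sup>2) \<longlongrightarrow> r) U"
    using form T unfolding kalton_swanson_form_def by blast
  have "of_real ((norm (tilde T))\<^sup>2) = (of_real r :: 'k)"
    using ip_norm[of "tilde T"] ip_tilde[OF T T] r(1) by simp
  then have "r = (norm (tilde T))\<^sup>2" by (simp only: of_real_eq_iff)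
  then have "((\<lambda>n. sqrt ((qnorm (T (unit_seq n, \<lambda>_. 0)))\<^sup>2)) \<longlongrightarrow> sqrt ((norm (tilde T))\<^sup>2)) U"
    using tendsto_real_sqrt[OF r(2)] by simp
  then show ?thesis by (simp add: qnorm_nonneg LZ2_range[OF T])
qed

text \<open>By \<open>qnorm_tendsto\<close> the norm in \<open>H\<close> is a limit along
  \<open>U\<close>, so an error that vanishes along the unit vectors leaves no trace in it.\<close>

lemma norm_tilde_le:
  assumes S: "S \<in> LZ2" and T: "T \<in> LZ2" and r: "r \<longlonglongrightarrow> 0"
    and le: "\<And>n. qnorm (S (unit_seq n, \<lambda>_. 0)) \<le> c * qnorm (T (unit_seq n, \<lambda>_. 0)) + r n"
  shows "norm (tilde S) \<le> c * norm (tilde T)"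
proof -
  have "(r \<longlongrightarrow> 0) U" by (rule filterlim_mono[OF r order_refl nontrivial_ultrafilter_le_sequentially[OF U]])
  then have "((\<lambda>n. c * qnorm (T (unit_seq n, \<lambda>_. 0)) + r n) \<longlongrightarrow> c * norm (tilde T) + 0) U"
    by (intro tendsto_intros qnorm_tendsto[OF T])
  from tendsto_le[OF U_ne this qnorm_tendsto[OF S]] show ?thesis using le by simp
qed

lemma norm_tilde_comp_le:
  assumes A: "A \<in> LZ2"
  obtains C where "C > 0" "\<And>T. T \<in> LZ2 \<Longrightarrow> norm (tilde (A \<circ> T)) \<le> C * norm (tilde T)"
proof -
  obtain C where C: "C > 0" "\<And>u. u \<in> Z2 \<Longrightarrow> qnorm (A u) \<le> C * qnorm u" using LZ2_bound[OF A] by metis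
  have "norm (tilde (A \<circ> T)) \<le> C * norm (tilde T)" if T: "T \<in> LZ2" for T
    by (rule norm_tilde_le[OF LZ2_comp[OF A T] T, where r="\<lambda>_. 0"]) (auto intro: C LZ2_range[OF T])
  with C(1) show ?thesis by (rule that)
qed

section \<open>Extension by density and the defining equation of the representation\<close>

lemma dense_closed_UNIV:
  assumes "closed K" "\<And>T. T \<in> LZ2 \<Longrightarrow> tilde T \<in> K"
  shows "x \<in> K"
  using closure_minimal[OF _ assms(1), of "tilde ` LZ2"] assms(2) tilde_dense by auto

lemma rep_exists:
  assumes A: "A \<in> LZ2"
  shows "\<exists>\<Phi>\<in>bounded_ops sc. \<forall>T\<in>LZ2. blinfun_apply \<Phi> (tilde T) = tilde (A \<circ> T)"
proof -
  obtain C where C: "C > 0" "\<And>T. T \<in> LZ2 \<Longrightarrow> norm (tilde (A \<circ> T)) \<le> C * norm (tilde T)"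
    using norm_tilde_comp_le[OF A] by metis
  define X where "X = tilde ` LZ2"
  \<comment> \<open>Any representative will do: by \<open>lip\<close>, operators with the same class
    have images with the same class.\<close>
  define g where "g h = tilde (A \<circ> (SOME T. T \<in> LZ2 \<and> tilde T = h))" for h
  have lip: "norm (tilde (A \<circ> S) - tilde (A \<circ> T)) \<le> C * norm (tilde S - tilde T)"
    if "S \<in> LZ2" "T \<in> LZ2" for S T
    using C(2)[OF diff_op_LZ2[OF that]] that A by (simp add: comp_diff_op tilde_diff LZ2_comp)
  have g: "g (tilde T) = tilde (A \<circ> T)" if T: "T \<in> LZ2" for T
  proof -
    let ?S = "SOME S. S \<in> LZ2 \<and> tilde S = tilde T"
    have "?S \<in> LZ2 \<and> tilde ?S = tilde T" by (rule someI[of _ T]) (use T in auto)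
    then show ?thesis using lip[of ?S T] T by (simp add: g_def)
  qed
  have "uniformly_continuous_on X g"
    unfolding uniformly_continuous_on_def
  proof (intro allI impI)
    fix e :: real assume e: "e > 0"
    show "\<exists>d>0. \<forall>x\<in>X. \<forall>x'\<in>X. dist x' x < d \<longrightarrow> dist (g x') (g x) < e"
    proof (intro exI[of _ "e / C"] conjI ballI impI)
      fix x x' assume x: "x \<in> X" "x' \<in> X" "dist x' x < e / C"
      obtain S T where "S \<in> LZ2" "T \<in> LZ2" "x' = tilde S" "x = tilde T" using x by (auto simp: X_def)
      then have "dist (g x') (g x) \<le> C * dist x' x" using lip[of S T] by (simp add: g dist_norm)
      also have "\<dots> < e" using x(3) C(1) by (simp add: field_simps)
      finally show "dist (g x') (g x) < e" .
    qed (use e C in auto)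
  qed
  then obtain G where "uniformly_continuous_on (closure X) G" and gG: "\<And>x. x \<in> X \<Longrightarrow> g x = G x"
  proof (rule uniformly_continuous_on_extension_on_closure)
    fix G assume "uniformly_continuous_on (closure X) G" "\<And>x. x \<in> X \<Longrightarrow> g x = G x"
    then show thesis by (rule that)
  qed
  then have cont: "continuous_on UNIV G"
    using tilde_dense uniformly_continuous_imp_continuous by (simp add: X_def)
  have G: "G (tilde T) = tilde (A \<circ> T)" if "T \<in> LZ2" for T
    using gG[of "tilde T"] g[OF that] that by (simp add: X_def)
  have cG: "continuous_on UNIV (\<lambda>x. G (f x))" if "continuous_on UNIV f" for f :: "'h \<Rightarrow> 'h"
    using continuous_on_compose2[OF cont that] by simp
  have cl: "closed {y. G (x + y) = G x + G y}" for x
    by (rule closed_Collect_eq; (rule cG)?; intro continuous_on_add continuous_on_const continuous_on_id cont)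
  \<comment> \<open>Density is used in one variable at a time, first with the other variable in the
    image of \<open>tilde\<close>.\<close>
  have add_tilde: "G (tilde T + y) = G (tilde T) + G y" if T: "T \<in> LZ2" for T y
  proof -
    have "y \<in> {y. G (tilde T + y) = G (tilde T) + G y}"
    proof (rule dense_closed_UNIV[OF cl])
      fix S :: "'k pair_op" assume S: "S \<in> LZ2"
      have "G (tilde T + tilde S) = tilde (add_op (A \<circ> T) (A \<circ> S))"
        using S T A by (simp add: G LZ2_add_op comp_add_op flip: tilde_add)
      then show "tilde S \<in> {y. G (tilde T + y) = G (tilde T) + G y}"
        using S T A by (simp add: G tilde_add LZ2_comp)
    qed
    then show ?thesis by simp
  qed
  have add: "G (x + y) = G x + G y" for x y
  proof -
    have "x \<in> {x. G (y + x) = G y + G x}"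
    proof (rule dense_closed_UNIV[OF cl])
      fix T :: "'k pair_op" assume "T \<in> LZ2"
      from add_tilde[OF this, of y] show "tilde T \<in> {x. G (y + x) = G y + G x}"
        by (simp only: mem_Collect_eq add.commute)
    qed
    then show ?thesis by (simp only: mem_Collect_eq add.commute)
  qed
  have scale: "G (sc a x) = sc a (G x)" for a x
  proof -
    have "x \<in> {x. G (sc a x) = sc a (G x)}"
    proof (rule dense_closed_UNIV)
      show "closed {x. G (sc a x) = sc a (G x)}"
        by (intro closed_Collect_eq cG bounded_linear.continuous_on[OF sc_bounded_linear] continuous_intros cont)
      fix S :: "'k pair_op" assume "S \<in> LZ2"
      then show "tilde S \<in> {x. G (sc a x) = sc a (G x)}"
        using A by (simp add: G tilde_scale[symmetric] LZ2_scale_op LZ2_comp comp_scale_op)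
    qed
    then show ?thesis by simp
  qed
  have "norm (G x) \<le> norm x * C" for x
  proof -
    have "x \<in> {x. norm (G x) \<le> norm x * C}"
      by (rule dense_closed_UNIV) (auto simp: G C mult.commute intro!: closed_Collect_le continuous_intros cont)
    then show ?thesis by simp
  qed
  then have bl: "bounded_linear G"
    by (intro bounded_linear_intro[where K=C] add) (simp_all add: scale flip: sc_of_real)
  show ?thesis
    by (rule bexI[of _ "Blinfun G"]) (auto simp: bounded_ops_def bounded_linear_Blinfun_apply[OF bl] scale G)
qed

lemma rep_unique:
  assumes "\<And>T. T \<in> LZ2 \<Longrightarrow> blinfun_apply \<Phi> (tilde T) = blinfun_apply \<Psi> (tilde T)"
  shows "\<Phi> = \<Psi>"
proof (rule blinfun_eqI)
  fix x
  have "x \<in> {x. blinfun_apply \<Phi> x = blinfun_apply \<Psi> x}"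
    by (rule dense_closed_UNIV) (simp_all add: assms closed_Collect_eq blinfun.continuous_on)
  then show "blinfun_apply \<Phi> x = blinfun_apply \<Psi> x" by simp
qed

abbreviation "rep \<equiv> kalton_swanson_rep sc tilde"

lemma rep_tilde:
  assumes A: "A \<in> LZ2" and T: "T \<in> LZ2"
  shows "blinfun_apply (rep A) (tilde T) = tilde (A \<circ> T)"
proof -
  have "\<exists>!\<Phi>. \<Phi> \<in> bounded_ops sc \<and> (\<forall>T\<in>LZ2. blinfun_apply \<Phi> (tilde T) = tilde (A \<circ> T))"
  proof (rule ex_ex1I)
    show "\<exists>\<Phi>. \<Phi> \<in> bounded_ops sc \<and> (\<forall>T\<in>LZ2. blinfun_apply \<Phi> (tilde T) = tilde (A \<circ> T))"
      using rep_exists[OF A] by blast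
  qed (simp add: rep_unique)
  from theI'[OF this, folded kalton_swanson_rep_def] T show ?thesis by blast
qed

lemma norm_rep_diff_le:
  assumes A: "A \<in> LZ2" and B: "B \<in> LZ2" and e: "e \<ge> 0"
    and le: "\<And>T. T \<in> LZ2 \<Longrightarrow> norm (tilde (diff_op A B \<circ> T)) \<le> e * norm (tilde T)"
  shows "norm (rep A - rep B) \<le> e"
proof (rule norm_blinfun_bound[OF e])
  fix x
  have "x \<in> {x. norm (blinfun_apply (rep A - rep B) x) \<le> e * norm x}"
  proof (rule dense_closed_UNIV)
    show "closed {x. norm (blinfun_apply (rep A - rep B) x) \<le> e * norm x}"
      by (intro closed_Collect_le continuous_intros)
    fix T :: "'k pair_op" assume T: "T \<in> LZ2"
    have "diff_op (A \<circ> T) (B \<circ> T) = diff_op A B \<circ> T"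
      by (simp add: diff_op_def add_op_def scale_op_def fun_eq_iff)
    then have "blinfun_apply (rep A - rep B) (tilde T) = tilde (diff_op A B \<circ> T)"
      using A B T by (simp add: blinfun.diff_left rep_tilde tilde_diff[symmetric] LZ2_comp)
    then show "tilde T \<in> {x. norm (blinfun_apply (rep A - rep B) x) \<le> e * norm x}" using le[OF T] by simp
  qed
  then show "norm (blinfun_apply (rep A - rep B) x) \<le> e * norm x" by simp
qed

text \<open>Turns relative closedness into closedness in the complete space of all bounded
  real-linear operators.\<close>

lemma bounded_ops_closed: "closed (bounded_ops sc)"
proof -
  have "bounded_ops sc = (\<Inter>a. \<Inter>x. {\<Phi>. blinfun_apply \<Phi> (sc a x) = sc a (blinfun_apply \<Phi> x)})"
    by (auto simp: bounded_ops_def)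
  also have "closed \<dots>"
    by (intro closed_INT ballI closed_Collect_eq bounded_linear.continuous_on[OF sc_bounded_linear] continuous_intros)
  finally show ?thesis .
qed

section \<open>Truncated block operators and their limit\<close>

definition partial_op :: "nat \<Rightarrow> 'k pair_op" where
  "partial_op n = diag_op (block_op (\<lambda>k. if k < n then 1 / real (k + 1) else 0))"

lemma partial_op_LZ2: "partial_op n \<in> LZ2"
  unfolding partial_op_def by (rule block_op_LZ2[where n=n]) auto

text \<open>The coefficients of the difference live on \<open>m \<le> k < n\<close> and are at most
  \<open>1 / (m + 1)\<close>. The commutator constant only multiplies second components of
  \<open>T (unit_seq n, 0)\<close>, which tend to 0 by \<open>snd_tendsto_0\<close>.\<close>

lemma rep_partial_op_diff:
  assumes "m \<le> n"
  shows "norm (rep (partial_op n) - rep (partial_op m)) \<le> 1 / real (m + 1)"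
proof (rule norm_rep_diff_le[OF partial_op_LZ2 partial_op_LZ2])
  let ?t = "\<lambda>n k. if k < n then 1 / real (k + 1) else 0"
  let ?c = "\<lambda>k. ?t n k - ?t m k"
  have diff: "diff_op (partial_op n) (partial_op m) = (diag_op (block_op ?c) :: 'k pair_op)"
    unfolding diff_op_def partial_op_def
    by (rule ext) (simp add: add_op_def scale_op_def diag_op_def add_pair_def scale_pair_def zero_pair_def
        block_op_diff fun_eq_iff)
  have A: "diag_op (block_op ?c) \<in> (LZ2 :: 'k pair_op set)"
    unfolding diff[symmetric] by (intro diff_op_LZ2 partial_op_LZ2)
  have c: "\<bar>?c k\<bar> \<le> 1 / real (m + 1)" for k using assms by (simp add: frac_le)
  obtain D where D: "\<And>u :: 'k seq_pair. u \<in> Z2 \<Longrightarrow>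
      qnorm (diag_op (block_op ?c) u) \<le> 1 / real (m + 1) * qnorm u + D * norm2 (snd u)"
    by (rule diag_block_op_estimate[OF A c]) (rule that)
  show "norm (tilde (diff_op (partial_op n) (partial_op m) \<circ> T)) \<le> 1 / real (m + 1) * norm (tilde T)"
    if T: "T \<in> LZ2" for T
    unfolding diff
  proof (rule norm_tilde_le[OF LZ2_comp[OF A T] T])
    show "(\<lambda>n. D * norm2 (snd (T (unit_seq n, \<lambda>_. 0)))) \<longlonglongrightarrow> 0"
      using tendsto_mult_left[OF snd_tendsto_0[OF T], of D] by simp
  qed (use D[OF LZ2_range[OF T]] in simp)
qed simp

text \<open>Agreement in \<open>H\<close> after selection becomes agreement of matrix entries up to
  \<epsilon> on enough blocks for \<open>hadamard_obstruction\<close>. The left side is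
  \<open>L / (k + 1)\<close>, since \<open>expo k = (k + 1) ^ 2\<close>.\<close>

lemma coefficient_bound:
  assumes B: "B \<in> LZ2" and C: "C > 0" "\<And>u. u \<in> Z2 \<Longrightarrow> qnorm (B u) \<le> C * qnorm u"
    and same: "\<And>i. tilde (B \<circ> select_op k i) = tilde (partial_op (Suc k) \<circ> select_op k i)"
  shows "real (k + 1) / 2 * ln 2 \<le> 4 * C + 1"
proof -
  define e where "e = expo k"
  define N :: real where "N = 2 ^ e"
  define L where "L = real e / 2 * ln 2"
  define c where "c = 1 / real (k + 1)"
  \<comment> \<open>Chosen so that the total error \<open>(L + L ^ 2) * (\<epsilon> * N ^ 2)\<close>
    stays below 1.\<close>
  define \<epsilon> where "\<epsilon> = 1 / (N ^ 2 * (L + L ^ 2 + 1))"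
  let ?A = "partial_op (Suc k)"
  let ?P = "{..<2 ^ e} \<times> {..<2 ^ e :: nat}"
  have N: "N > 0" and L: "L \<ge> 0" by (auto simp: N_def L_def)
  have \<epsilon>: "\<epsilon> > 0" using N L by (auto simp: \<epsilon>_def intro!: mult_pos_pos add_nonneg_pos)
  let ?v = "\<lambda>i j. diff_op B ?A (unit_seq (coord k j i), \<lambda>_. 0)"
  have "eventually (\<lambda>j. qnorm (?v i j) < \<epsilon>) U" for i
  proof -
    let ?T = "diff_op (B \<circ> select_op k i) (?A \<circ> select_op k i)"
    have T: "?T \<in> LZ2" by (intro diff_op_LZ2 LZ2_comp B partial_op_LZ2 select_op_LZ2)
    have "norm (tilde ?T) = 0"
      using same by (simp add: tilde_diff LZ2_comp B partial_op_LZ2 select_op_LZ2)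
    moreover have "?T (unit_seq j, \<lambda>_. 0) = ?v i j" for j
      by (simp add: diff_op_def add_op_def scale_op_def select_op_unit)
    ultimately have "((\<lambda>j. qnorm (?v i j)) \<longlongrightarrow> 0) U" using qnorm_tendsto[OF T] by simp
    then show ?thesis using \<epsilon> by (rule order_tendstoD(2))
  qed
  then have ev: "eventually (\<lambda>j. \<forall>i\<in>{..<2 ^ e}. qnorm (?v i j) < \<epsilon>) U"
    by (intro eventually_ball_finite) auto
  define G where "G = {j. \<forall>i\<in>{..<2 ^ e}. qnorm (?v i j) < \<epsilon>}"
  have "infinite G"
  proof
    assume "finite G"
    then have "eventually (\<lambda>j. \<forall>m\<in>G. j \<noteq> m) U"
      using U by (intro eventually_ball_finite) (auto simp: nontrivial_ultrafilter_def)
    with ev have "eventually (\<lambda>j. False) U" by eventually_elim (auto simp: G_def)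
    then show False using U_ne by (simp add: trivial_limit_def)
  qed
  \<comment> \<open>The obstruction uses \<open>2 ^ e\<close> distinct blocks in which every
    position is good; enumerating the infinite set \<open>G\<close> supplies them.\<close>
  define J where "J = enumerate G"
  have J: "J a \<in> G" "strict_mono J" for a
    using \<open>infinite G\<close> by (auto simp: J_def enumerate_in_set strict_mono_enumerate)
  define pos where "pos p = coord k (J (snd p)) (fst p)" for p
  have inj: "inj_on pos ?P" using strict_mono_eq[OF J(2)] by (auto simp: inj_on_def pos_def)
  have AB: "norm (fst (B (unit_seq (pos p), \<lambda>_. 0)) (pos q) - of_real (c * walsh_id e p q)) \<le> \<epsilon> \<and>
      norm (snd (B (unit_seq (pos p), \<lambda>_. 0)) (pos q)) \<le> \<epsilon>" if "p \<in> ?P" "q \<in> ?P" for p q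
  proof -
    let ?u = "(unit_seq (pos p), \<lambda>_. 0) :: 'k seq_pair"
    obtain x y where xy: "diff_op B ?A ?u = (x, y)" by (cases "diff_op B ?A ?u")
    have "(x, y) \<in> Z2" using LZ2_range[OF diff_op_LZ2[OF B partial_op_LZ2], of "Suc k" ?u] xy by simp
    then have y: "y \<in> ell2" and x: "(\<lambda>n. x n - Omega y n) \<in> ell2" by (auto simp: Z2_iff)
    have "fst p \<in> {..<2 ^ e}" using that by auto
    then have "qnorm (diff_op B ?A ?u) < \<epsilon>" using J(1)[of "snd p"] unfolding G_def pos_def by blast
    then have "qnorm (x, y) < \<epsilon>" unfolding xy .
    then have q: "norm2 (\<lambda>n. x n - Omega y n) + norm2 y < \<epsilon>" by (simp add: qnorm_Pair)
    have "norm (y (pos q)) \<le> \<epsilon>"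
      using norm_le_norm2[OF y, of "pos q"] norm2_nonneg[OF x] q by simp
    moreover have "norm (x (pos q)) \<le> \<epsilon>"
    proof -
      \<comment> \<open>The quasi-norm controls \<open>x\<close> only up to \<open>Omega y\<close>,
        but each entry of \<open>Omega y\<close> is at most \<open>norm2 y\<close>.\<close>
      have "norm (Omega y (pos q)) \<le> norm2 y"
        using mult_abs_ln_le[OF norm_ge_zero norm_le_norm2[OF y, of "pos q"]]
        by (simp add: Omega_apply norm_mult)
      moreover have "norm (x (pos q)) \<le> norm (x (pos q) - Omega y (pos q)) + norm (Omega y (pos q))"
        by (metis add.commute norm_triangle_sub)
      ultimately show ?thesis using norm_le_norm2[OF x, of "pos q"] q by simp
    qed
    moreover have "?A ?u = (block_op (\<lambda>l. if l < Suc k then 1 / real (l + 1) else 0) (unit_seq (pos p)), \<lambda>_. 0)"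
      by (simp add: partial_op_def diag_op_def unit_seq_Z2) (simp add: block_op_def fun_eq_iff)
    moreover have "block_op (\<lambda>l. if l < Suc k then 1 / real (l + 1) else 0) (unit_seq (pos p)) (pos q)
        = (of_real (c * walsh_id e p q) :: 'k)"
    proof -
      have "walsh_id e (fst p, J (snd p)) (fst q, J (snd q)) = walsh_id e p q"
        using strict_mono_eq[OF J(2)] by (simp add: walsh_id_def)
      then show ?thesis unfolding pos_def
        using that by (subst block_op_unit) (auto simp: e_def c_def)
    qed
    ultimately show ?thesis
      using xy by (auto simp: diff_op_def add_op_def scale_op_def add_pair_def scale_pair_def)
  qed
  have "L * (c * N ^ 2 - \<epsilon> * N ^ 4) \<le> 4 * C * N ^ 2 + L ^ 2 * (\<epsilon> * N ^ 4)"
    unfolding L_def N_def by (rule hadamard_obstruction[OF B C(2) inj]) (use AB in auto)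
  then have "N ^ 2 * (L * c) \<le> N ^ 2 * (4 * C + (L + L ^ 2) * (\<epsilon> * N ^ 2))"
    by (simp add: algebra_simps power2_eq_square power4_eq_xxxx)
  then have "L * c \<le> 4 * C + (L + L ^ 2) * (\<epsilon> * N ^ 2)" using N by simp
  also have "(L + L ^ 2) * (\<epsilon> * N ^ 2) \<le> 1"
  proof -
    have "\<epsilon> * N ^ 2 = 1 / (L + L ^ 2 + 1)" using N by (simp add: \<epsilon>_def)
    then have "(L + L ^ 2) * (\<epsilon> * N ^ 2) = (L + L ^ 2) / (L + L ^ 2 + 1)" by simp
    moreover have "L + L ^ 2 + 1 > 0" using L by (intro add_nonneg_pos) auto
    ultimately show ?thesis by simp
  qed
  also have "L * c = real (k + 1) / 2 * ln 2"
    by (simp add: L_def c_def e_def expo_def power2_eq_square field_simps)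
  finally show ?thesis by simp
qed

text \<open>The images of the truncations form a Cauchy sequence. A limit \<open>rep B\<close> would
  satisfy \<open>coefficient_bound\<close> with one constant \<open>C\<close> for all
  \<open>k\<close>.\<close>

lemma range_rep_not_closed: "\<not> closedin (top_of_set (bounded_ops sc)) (rep ` LZ2)"
proof
  assume "closedin (top_of_set (bounded_ops sc)) (rep ` LZ2)"
  then have closed: "closed (rep ` LZ2)"
    by (rule closedin_closed_trans) (rule bounded_ops_closed)
  let ?S = "\<lambda>n. rep (partial_op n)"
  have "Cauchy ?S"
  proof (rule metric_CauchyI)
    fix e :: real assume "e > 0"
    then obtain M :: nat where M: "1 / real (M + 1) < e / 2"
      using reals_Archimedean[of "e / 2"] by (auto simp: field_simps)
    have "dist (?S m) (?S M) < e / 2" if "m \<ge> M" for m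
      using rep_partial_op_diff[OF that] M by (simp add: dist_norm)
    then have "dist (?S m) (?S n) < e" if "m \<ge> M" "n \<ge> M" for m n
      by (rule dist_triangle_half_l[of _ "?S M"]) (use that \<open>\<And>m. m \<ge> M \<Longrightarrow> dist (?S m) (?S M) < e / 2\<close> in auto)
    then show "\<exists>M. \<forall>m\<ge>M. \<forall>n\<ge>M. dist (?S m) (?S n) < e" by blast
  qed
  then obtain \<Phi> where \<Phi>: "?S \<longlonglongrightarrow> \<Phi>" unfolding Cauchy_convergent_iff convergent_def by (rule exE)
  have "\<Phi> \<in> rep ` LZ2"
    by (rule closed_sequentially[OF closed _ \<Phi>]) (rule imageI, rule partial_op_LZ2)
  then obtain B where B: "B \<in> LZ2" "\<Phi> = rep B" by (rule imageE)
  obtain C where C: "C > 0" "\<And>u. u \<in> Z2 \<Longrightarrow> qnorm (B u) \<le> C * qnorm u" using LZ2_bound[OF B(1)] by metis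
  have same: "tilde (B \<circ> select_op k i) = tilde (partial_op (Suc k) \<circ> select_op k i)" for k i
  proof -
    have "(\<lambda>n. blinfun_apply (?S n) (tilde (select_op k i))) \<longlonglongrightarrow> blinfun_apply \<Phi> (tilde (select_op k i))"
      by (rule blinfun.tendsto[OF \<Phi> tendsto_const])
    then have "(\<lambda>n. tilde (partial_op n \<circ> select_op k i)) \<longlonglongrightarrow> tilde (B \<circ> select_op k i)"
      unfolding B(2) by (simp only: B(1) rep_tilde partial_op_LZ2 select_op_LZ2)
    \<comment> \<open>Truncation keeps the coefficients with index below \<open>n\<close>, so from
      \<open>n = Suc k\<close> on the one at \<open>k\<close> no longer changes.\<close>
    moreover have "eventually (\<lambda>n. tilde (partial_op n \<circ> select_op k i) =
        tilde (partial_op (Suc k) \<circ> select_op k i)) sequentially"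
    proof (rule eventually_sequentiallyI)
      fix n assume "n \<ge> Suc k"
      then have "partial_op n \<circ> select_op k i = partial_op (Suc k) \<circ> select_op k i"
        unfolding partial_op_def by (intro block_op_select_op) simp
      then show "tilde (partial_op n \<circ> select_op k i) = tilde (partial_op (Suc k) \<circ> select_op k i)"
        by (rule arg_cong)
    qed
    then have "(\<lambda>n. tilde (partial_op n \<circ> select_op k i)) \<longlonglongrightarrow> tilde (partial_op (Suc k) \<circ> select_op k i)"
      by (rule tendsto_eventually)
    ultimately show ?thesis by (rule LIMSEQ_unique)
  qed
  obtain k :: nat where "(4 * C + 1) / (ln 2 / 2) < k" using reals_Archimedean2 by blast
  then have "4 * C + 1 < real k * (ln 2 / 2)" by (simp add: field_simps)
  also have "\<dots> \<le> real (k + 1) / 2 * ln 2" by (simp add: field_simps)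
  finally have "4 * C + 1 < real (k + 1) / 2 * ln 2" .
  with coefficient_bound[OF B(1) C same, of k] show False by simp
qed

end

theorem theorem1p8:
  fixes U :: "nat filter"
    and form :: "'k::real_or_complex pair_op \<Rightarrow> 'k pair_op \<Rightarrow> 'k"
    and sc :: "'k \<Rightarrow> 'h::banach \<Rightarrow> 'h"
    and ip :: "'h \<Rightarrow> 'h \<Rightarrow> 'k"
    and tilde :: "'k pair_op \<Rightarrow> 'h"
  assumes "nontrivial_ultrafilter U"
    and "kalton_swanson_form U form"
    and "completion_of_form form sc ip tilde"
  shows "\<not> closedin (top_of_set (bounded_ops sc)) (kalton_swanson_rep sc tilde ` LZ2)"
proof -
  interpret kalton_swanson U form sc ip tilde by unfold_locales (use assms in auto)
  show ?thesis by (rule range_rep_not_closed)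
qed

end
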